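(* Let $\lambda_0\in\mathbb R$ be such that $\mathfrak D(\lambda_0)=\pm2$, but $M(\lambda_0)\ne\pm\mathbb I$. Then $$\lim_{\lambda\to\lambda_0}\Gamma(M(\lambda))=0,$$ where the limit $\lambda\to\lambda_0$ is taken over complex $\lambda\ne\lambda_0$.
   Context: Setting: $m\ge0$, $a>0$, and $q:\mathbb R\to\mathbb R$ is locally integrable and $a$-periodic. Pauli matrices: $\sigma_2=\begin{pmatrix}0&-i\\i&0\end{pmatrix}$, $\sigma_3=\begin{pmatrix}1&0\\0&-1\end{pmatrix}$; $\mathbb I$ is the $2\times2$ unit matrix; $|w|=\sqrt{|w_1|^2+|w_2|^2}$ for $w\in\mathbb C^2$. For $\lambda\in\mathbb C$, $\Phi(\cdot,\lambda)$ is the $2\times2$ matrix solution of $-i\sigma_2\Phi'+(m\sigma_3+q)\Phi=\lambda\Phi$ on $\mathbb R$, $\Phi(0,\lambda)=\mathbb I$. The monodromy matrix is $M(\lambda)=\Phi(a,\lambda)$ (an entire function of $\lambda$, of determinant 1), the discriminant is $\mathfrak D(\lambda)=\operatorname{Tr}M(\lambda)$. For a matrix $A\in\mathbb C^{2\times2}$ with two distinct eigenvalues, $\Gamma(A)=\dfrac{|\det(w_+,w_-)|}{|w_+|\,|w_-|}\in(0,1]$, where $w_\pm\in\mathbb C^2\setminus\{0\}$ are eigenvectors of $A$ for the two different eigenvalues (independent of the choice of eigenvectors). $M(\lambda)$ has two distinct eigenvalues if and only if $\mathfrak D(\lambda)\notin\{-2,2\}$, which holds for all $\lambda\ne\lambda_0$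 sufficiently close to $\lambda_0$. *)

theory Defs
  imports "HOL-Analysis.Analysis"
begin

definition sigma2 :: "complex^2^2" where
  "sigma2 = vector [vector [0, - \<i>], vector [\<i>, 0]]"

definition sigma3 :: "complex^2^2" where
  "sigma3 = vector [vector [1, 0], vector [0, - 1]]"

definition locally_integrable :: "(real \<Rightarrow> real) \<Rightarrow> bool" where
  "locally_integrable q \<longleftrightarrow> (\<forall>u v. q absolutely_integrable_on {u..v})"

text \<open>The members of \<open>d\<close> are finitely many non-overlapping compact intervals
  \<open>{Inf K..Sup K}\<close>; they need not cover \<open>{u..v}\<close>.\<close>

definition locally_absolutely_continuous :: "(real \<Rightarrow> 'a::metric_space) \<Rightarrow> bool" where
  "locally_absolutely_continuous f \<longleftrightarrow>
     (\<forall>u v. \<forall>\<epsilon>>0. \<exists>\<delta>>0. \<forall>d.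
        d division_of \<Union>d \<and> \<Union>d \<subseteq> {u..v} \<and> (\<Sum>K\<in>d. Sup K - Inf K) < \<delta>
          \<longrightarrow> (\<Sum>K\<in>d. dist (f (Inf K)) (f (Sup K))) < \<epsilon>)"

text \<open>Since \<open>q\<close> is only locally integrable, the equation
  \<open>-i \<sigma>\<^sub>2 Y' + (m \<sigma>\<^sub>3 + q) Y = lam Y\<close> is understood in the sense of Caratheodory:
  \<open>Y\<close> is locally absolutely continuous and the equation holds almost everywhere.
  Here \<open>mat c\<close> is \<open>c\<close> times the unit matrix, so \<open>mat c ** A\<close> is the scalar multiple \<open>c A\<close>.\<close>

definition dirac_solution ::
  "real \<Rightarrow> (real \<Rightarrow> real) \<Rightarrow> complex \<Rightarrow> (real \<Rightarrow> complex^2^2) \<Rightarrow> bool" where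
  "dirac_solution m q lam Y \<longleftrightarrow>
     locally_absolutely_continuous Y \<and>
     (AE x in lebesgue. \<exists>Y'. (Y has_vector_derivative Y') (at x) \<and>
        mat (- \<i>) ** sigma2 ** Y'
          + (mat (complex_of_real m) ** sigma3 + mat (complex_of_real (q x))) ** Y x
        = mat lam ** Y x)"

text \<open>These two conditions determine \<open>\<Phi>\<close> uniquely.\<close>

definition fundamental_solution ::
  "real \<Rightarrow> (real \<Rightarrow> real) \<Rightarrow> (real \<Rightarrow> complex \<Rightarrow> complex^2^2) \<Rightarrow> bool" where
  "fundamental_solution m q \<Phi> \<longleftrightarrow>
     (\<forall>lam. dirac_solution m q lam (\<lambda>x. \<Phi> x lam) \<and> \<Phi> 0 lam = mat 1)"

definition monodromy ::
  "real \<Rightarrow> (real \<Rightarrow> complex \<Rightarrow> complex^2^2) \<Rightarrow> complex \<Rightarrow> complex^2^2" where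
  "monodromy a \<Phi> lam = \<Phi> a lam"

definition discriminant ::
  "real \<Rightarrow> (real \<Rightarrow> complex \<Rightarrow> complex^2^2) \<Rightarrow> complex \<Rightarrow> complex" where
  "discriminant a \<Phi> lam = trace (monodromy a \<Phi> lam)"

definition eigenvector_for :: "complex^2^2 \<Rightarrow> complex \<Rightarrow> complex^2 \<Rightarrow> bool" where
  "eigenvector_for A \<mu> w \<longleftrightarrow> w \<noteq> 0 \<and> A *v w = \<mu> *s w"

text \<open>The matrix \<open>transpose (vector [w, z])\<close> has the columns \<open>w\<close> and \<open>z\<close>. The value is
  unspecified if \<open>A\<close> does not have two distinct
  eigenvalues.\<close>

definition eigenvector_Gamma :: "complex^2^2 \<Rightarrow> real" where
  "eigenvector_Gamma A =
     (THE g. \<exists>\<mu> \<nu> w z. \<mu> \<noteq> \<nu> \<and> eigenvector_for A \<mu> w \<and> eigenvector_for A \<nu> z \<and>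
        g = cmod (det (transpose (vector [w, z]) :: complex^2^2)) / (norm w * norm z))"

end

theory Submission
  imports Defs
begin

text \<open>For a \<open>2 \<times> 2\<close> matrix \<open>A\<close> with traceless part \<open>B\<close> and
  \<open>\<Delta> = (tr A)\<^sup>2 - 4 det A \<noteq> 0\<close> one has \<open>\<Gamma>(A)\<^sup>2 = |\<Delta>| / (\<parallel>B\<parallel>\<^sup>2 + |\<Delta>|/2)\<close>, with the
  Frobenius norm. At \<open>lam0\<close> the monodromy matrix has \<open>\<Delta> = 0\<close> and \<open>B \<noteq> 0\<close>, so the limit is \<open>0\<close> by
  continuity once \<open>\<Delta> \<noteq> 0\<close> is known in a punctured neighbourhood. Wronskians of solutions at \<open>lam0\<close>
  and at \<open>lam\<close> give both continuity in \<open>lam\<close> and the derivative of the discriminant at \<open>lam0\<close>,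
  which is the integral of a quadratic form in the (real) fundamental solution whose own
  discriminant is \<open>\<Delta> = 0\<close>. The form is thus semidefinite, and it is not zero because \<open>B \<noteq> 0\<close>;
  hence the derivative does not vanish.\<close>

subsection \<open>Absolutely continuous functions\<close>

lemma locally_absolutely_continuousD:
  assumes "locally_absolutely_continuous f" "\<epsilon> > 0"
  obtains \<delta> where "\<delta> > 0"
    "\<And>d. d division_of \<Union>d \<Longrightarrow> \<Union>d \<subseteq> {u..v} \<Longrightarrow> (\<Sum>K\<in>d. Sup K - Inf K) < \<delta> \<Longrightarrow>
       (\<Sum>K\<in>d. dist (f (Inf K)) (f (Sup K))) < \<epsilon>"
proof -
  have "\<exists>\<delta>>0. \<forall>d. d division_of \<Union>d \<and> \<Union>d \<subseteq> {u..v} \<and> (\<Sum>K\<in>d. Sup K - Inf K) < \<delta> \<longrightarrow>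
      (\<Sum>K\<in>d. dist (f (Inf K)) (f (Sup K))) < \<epsilon>"
    using assms unfolding locally_absolutely_continuous_def by blast
  then show thesis using that by blast
qed

lemma locally_absolutely_continuous_imp_continuous_on:
  fixes f :: "real \<Rightarrow> 'a::metric_space"
  assumes "locally_absolutely_continuous f"
  shows "continuous_on {u..v} f"
proof -
  have "uniformly_continuous_on {u..v} f"
    unfolding uniformly_continuous_on_def
  proof (intro allI impI)
    fix e :: real assume "e > 0"
    then obtain \<delta> where d: "\<delta> > 0"
      and D: "\<And>d. d division_of \<Union>d \<Longrightarrow> \<Union>d \<subseteq> {u..v} \<Longrightarrow> (\<Sum>K\<in>d. Sup K - Inf K) < \<delta> \<Longrightarrow>
       (\<Sum>K\<in>d. dist (f (Inf K)) (f (Sup K))) < e"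
      using locally_absolutely_continuousD[OF assms, of e u v] by blast
    have *: "dist (f x) (f y) < e" if "x \<le> y" "x \<in> {u..v}" "y \<in> {u..v}" "dist y x < \<delta>" for x y
    proof -
      \<comment> \<open>Absolute continuity is applied to a division with a single member; uniform
        continuity needs no more.\<close>
      have "{{x..y}} division_of \<Union>{{x..y}}"
        using division_of_self[of x y] that by auto
      from D[OF this] show ?thesis using that by (auto simp: dist_real_def)
    qed
    show "\<exists>d>0. \<forall>x\<in>{u..v}. \<forall>x'\<in>{u..v}. dist x' x < d \<longrightarrow> dist (f x') (f x) < e"
      using d * by (metis dist_commute linorder_le_cases)
  qed
  then show ?thesis by (rule uniformly_continuous_imp_continuous)
qed

text \<open>Splitting the increment at the tag \<open>x\<close> gives the errors
  \<open>e * (x - u)\<close> and \<open>e * (v - x)\<close>. They add up to exactly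
  \<open>e * (v - u)\<close> because \<open>x\<close> lies between \<open>u\<close> and
  \<open>v\<close>.\<close>

lemma has_vector_derivative_straddle:
  fixes f :: "real \<Rightarrow> 'a::real_normed_vector"
  assumes "(f has_vector_derivative f') (at x)" "e > 0"
  obtains d where "d > 0"
    "\<And>u v. u \<le> x \<Longrightarrow> x \<le> v \<Longrightarrow> {u..v} \<subseteq> ball x d \<Longrightarrow>
       norm ((v - u) *\<^sub>R f' - (f v - f u)) \<le> e * (v - u)"
proof -
  obtain d where "d > 0"
    and d: "\<And>y. norm (y - x) < d \<Longrightarrow> norm (f y - f x - (y - x) *\<^sub>R f') \<le> e * norm (y - x)"
    using assms unfolding has_vector_derivative_def has_derivative_at_alt by blast
  have "norm ((v - u) *\<^sub>R f' - (f v - f u)) \<le> e * (v - u)"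
    if uv: "u \<le> x" "x \<le> v" "{u..v} \<subseteq> ball x d" for u v
  proof -
    have "u \<in> {u..v}" "v \<in> {u..v}" using uv by auto
    then have "u \<in> ball x d" "v \<in> ball x d" using uv(3) by blast+
    then have "norm (u - x) < d" "norm (v - x) < d" by (auto simp: dist_real_def)
    from this[THEN d] uv
    have "norm (f u - f x - (u - x) *\<^sub>R f') + norm (f v - f x - (v - x) *\<^sub>R f') \<le> e * (x - u) + e * (v - x)"
      by auto
    moreover have "(v - u) *\<^sub>R f' - (f v - f u)
        = (f u - f x - (u - x) *\<^sub>R f') - (f v - f x - (v - x) *\<^sub>R f')"
      by (auto simp: algebra_simps)
    ultimately show ?thesis
      using norm_triangle_ineq4[of "f u - f x - (u - x) *\<^sub>R f'" "f v - f x - (v - x) *\<^sub>R f'"]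
      by (simp add: algebra_simps)
  qed
  with \<open>d > 0\<close> that show thesis by blast
qed

lemma null_set_open_cover:
  fixes N :: "real set"
  assumes "N \<in> null_sets lebesgue" "\<delta> > 0"
  obtains T where "open T" "N \<subseteq> T" "T \<in> lmeasurable" "measure lebesgue T < \<delta>"
proof -
  have N: "N \<in> sets lebesgue" using assms by auto
  obtain T where T: "open T" "N \<subseteq> T" "(T - N) \<in> lmeasurable" "emeasure lebesgue (T - N) < ennreal \<delta>"
    using sets_lebesgue_outer_open[OF N assms(2)] by metis
  have NL: "N \<in> lmeasurable" using assms(1) by (simp add: fmeasurableI_null_sets)
  have eq: "T = (T - N) \<union> N" using T by auto
  then have "T \<in> lmeasurable" using T NL by (metis fmeasurable.Un)
  moreover have "measure lebesgue T = measure lebesgue (T - N)"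
    using measure_Un_null_set[of "T - N" lebesgue N] T(3) assms(1) eq by auto
  moreover have "measure lebesgue (T - N) < \<delta>"
    using T(3,4) assms(2) by (simp add: emeasure_eq_measure2 ennreal_less_iff)
  ultimately show thesis using T that by metis
qed

text \<open>Bridges two notions of smallness: a division inside a cover of small measure satisfies
  the length condition in the definition of absolute continuity.\<close>

lemma division_length_le_measure:
  fixes d :: "real set set"
  assumes "d division_of \<Union>d" "\<Union>d \<subseteq> T" "T \<in> lmeasurable"
  shows "(\<Sum>K\<in>d. Sup K - Inf K) \<le> measure lebesgue T"
proof -
  have "Sup K - Inf K = measure lebesgue K" if Kd: "K \<in> d" for K
  proof -
    obtain u v where "K = cbox u v" using division_ofD(4)[OF assms(1) Kd] by blast
    moreover have "K \<noteq> {}" by (rule division_ofD(3)[OF assms(1) Kd])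
    ultimately show ?thesis by simp
  qed
  then have "(\<Sum>K\<in>d. Sup K - Inf K) = measure lebesgue (\<Union>d)"
    using content_division[OF assms(1)] by simp
  also have "\<dots> \<le> measure lebesgue T"
    using assms by (intro measure_mono_fmeasurable) (auto intro: fmeasurableD lmeasurable_division)
  finally show ?thesis .
qed

text \<open>Tags in the exceptional null set \<open>N\<close> are forced by the gauge into an open set of small
  measure, where absolute continuity controls the increments; at the other tags the derivative does.\<close>

theorem fundamental_theorem_of_calculus_absolutely_continuous:
  fixes f :: "real \<Rightarrow> 'a::banach"
  assumes ac: "locally_absolutely_continuous f"
    and der: "AE x in lebesgue. (f has_vector_derivative h x) (at x)"
    and "a \<le> b"
  shows "(h has_integral (f b - f a)) {a..b}"
proof -
  obtain N where N: "N \<in> null_sets lebesgue"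
    and hN: "\<And>x. x \<notin> N \<Longrightarrow> (f has_vector_derivative h x) (at x)"
    using der by (auto elim!: AE_E3)
  \<comment> \<open>With the value 0 on \<open>N\<close>, a tag in \<open>N\<close> contributes
    nothing but an increment of \<open>f\<close>. The change is on a negligible set and is undone at
    the end by \<open>has_integral_spike\<close>.\<close>
  define g where "g x = (if x \<in> N then 0 else h x)" for x
  have "(g has_integral (f b - f a)) {a..b}"
    unfolding has_integral_real
  proof (intro allI impI)
    fix E :: real assume "E > 0"
    \<comment> \<open>The error budget is \<open>e\<close> for all tags in \<open>N\<close> together
      and \<open>e * (b - a)\<close> for the others. The summand 1 keeps the denominator positive
      when \<open>a = b\<close>, and the factor 2 makes the final bound strict.\<close>
    define e where "e = E / (2 * (1 + (b - a)))"
    have e: "e > 0" and eE: "e + e * (b - a) < E"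
    proof -
      show "e > 0" using \<open>E > 0\<close> \<open>a \<le> b\<close> by (simp add: e_def)
      have "1 + (b - a) \<noteq> 0" using \<open>a \<le> b\<close> by simp
      then have "e * (1 + (b - a)) = E / 2" unfolding e_def by (metis divide_divide_eq_left nonzero_eq_divide_eq)
      then have "e + e * (b - a) = E / 2" by (simp add: algebra_simps)
      then show "e + e * (b - a) < E" using \<open>E > 0\<close> by simp
    qed
    obtain \<delta> where d: "\<delta> > 0"
      and D: "\<And>d. d division_of \<Union>d \<Longrightarrow> \<Union>d \<subseteq> {a..b} \<Longrightarrow> (\<Sum>K\<in>d. Sup K - Inf K) < \<delta> \<Longrightarrow>
       (\<Sum>K\<in>d. dist (f (Inf K)) (f (Sup K))) < e"
      using locally_absolutely_continuousD[OF ac e, of a b] by blast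
    obtain T where T: "open T" "N \<subseteq> T" "T \<in> lmeasurable" "measure lebesgue T < \<delta>"
      using null_set_open_cover[OF N d] by blast
    have "\<forall>x. \<exists>r>0. x \<notin> N \<longrightarrow> (\<forall>u v. u \<le> x \<longrightarrow> x \<le> v \<longrightarrow> {u..v} \<subseteq> ball x r \<longrightarrow>
       norm ((v - u) *\<^sub>R h x - (f v - f u)) \<le> e * (v - u))"
      using has_vector_derivative_straddle[OF hN e] by (metis zero_less_one)
    then obtain r where r: "\<And>x. r x > 0"
      and R: "\<And>x u v. x \<notin> N \<Longrightarrow> u \<le> x \<Longrightarrow> x \<le> v \<Longrightarrow> {u..v} \<subseteq> ball x (r x) \<Longrightarrow>
       norm ((v - u) *\<^sub>R h x - (f v - f u)) \<le> e * (v - u)" by metis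
    define \<gamma> where "\<gamma> x = (if x \<in> N then T else ball x (r x))" for x
    have "gauge \<gamma>"
      using T r by (auto simp: gauge_def \<gamma>_def)
    moreover have "norm ((\<Sum>(x, K)\<in>p. measure lborel K *\<^sub>R g x) - (f b - f a)) < E"
      if p: "p tagged_division_of {a..b}" and fine: "\<gamma> fine p" for p
    proof -
      have fin: "finite p" using p by blast
      have ivl: "\<exists>u v. K = {u..v} \<and> u \<le> x \<and> x \<le> v \<and> a \<le> u \<and> v \<le> b" if xK: "(x, K) \<in> p" for x K
      proof -
        obtain u v where "K = cbox u v" using tagged_division_ofD(4)[OF p xK] by blast
        moreover have "x \<in> K" "K \<subseteq> {a..b}" using tagged_division_ofD(2,3)[OF p xK] by auto
        ultimately show ?thesis by auto
      qed
      have ba: "b - a = (\<Sum>(x,K)\<in>p. Sup K - Inf K)" "f b - f a = (\<Sum>(x,K)\<in>p. f (Sup K) - f (Inf K))"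
        using additive_tagged_division_1[OF \<open>a \<le> b\<close>, of p "\<lambda>x. x"]
          additive_tagged_division_1[OF \<open>a \<le> b\<close>, of p f] p by auto
      define p1 where "p1 = {(x, K) \<in> p. x \<in> N}"
      have sub: "p1 \<subseteq> p" by (auto simp: p1_def)
      let ?t = "\<lambda>(x, K). norm (measure lborel K *\<^sub>R g x - (f (Sup K) - f (Inf K)))"
      have part: "p1 tagged_partial_division_of {a..b}"
        using p by (intro tagged_partial_division_subset[OF _ sub]) (simp add: tagged_division_of_def)
      have div: "snd ` p1 division_of \<Union>(snd ` p1)"
        using part by (rule partial_division_of_tagged_division)
      have "\<Union>(snd ` p1) \<subseteq> T"
      proof clarify
        fix t x K assume "(x, K) \<in> p1" "t \<in> snd (x, K)"
        then have "K \<subseteq> \<gamma> x" "x \<in> N" "t \<in> K" using fine by (auto simp: fine_def p1_def)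
        then show "t \<in> T" by (auto simp: \<gamma>_def)
      qed
      moreover have sub2: "\<Union>(snd ` p1) \<subseteq> {a..b}"
        using tagged_partial_division_ofD(3)[OF part] by (intro Union_least) force
      ultimately have "(\<Sum>K\<in>snd ` p1. Sup K - Inf K) < \<delta>"
        using division_length_le_measure[OF div _ T(3)] T(4) by linarith
      then have "(\<Sum>K\<in>snd ` p1. dist (f (Inf K)) (f (Sup K))) < e"
        using D[OF div sub2] by simp
      moreover have "sum ?t p1 = (\<Sum>K\<in>snd ` p1. dist (f (Inf K)) (f (Sup K)))"
      proof -
        \<comment> \<open>Passing from tagged pairs to intervals could lose terms, since one
          interval may carry several tags. This can happen only for intervals with empty interior,
          so the summand must vanish on those. The guard covers the empty box, where
          \<open>Inf\<close> and \<open>Sup\<close> say nothing; one-point intervals give distance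
          0.\<close>
        let ?d = "\<lambda>K. if K = {} then 0 else dist (f (Inf K)) (f (Sup K))"
        have "sum ?t p1 = (\<Sum>(x, K)\<in>p1. ?d K)"
        proof (rule sum.cong[OF refl], clarify)
          fix x K assume xK: "(x, K) \<in> p1"
          have "x \<in> K" using xK by (rule tagged_partial_division_ofD(2)[OF part])
          moreover have "x \<in> N" using xK by (simp add: p1_def)
          ultimately show "norm (measure lborel K *\<^sub>R g x - (f (Sup K) - f (Inf K))) = ?d K"
            by (auto simp: g_def dist_norm norm_minus_commute)
        qed
        also have "\<dots> = (\<Sum>K\<in>snd ` p1. ?d K)"
        proof (rule sum.over_tagged_division_lemma[OF tagged_partial_division_of_Union_self[OF part]])
          fix u v :: real assume "box u v = {}"
          then show "?d (cbox u v) = 0"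
            by (cases "u = v") auto
        qed
        also have "\<dots> = (\<Sum>K\<in>snd ` p1. dist (f (Inf K)) (f (Sup K)))"

        proof (rule sum.cong[OF refl])
          fix K assume "K \<in> snd ` p1"
          then obtain x where "(x, K) \<in> p1" by force
          then have "x \<in> K" by (rule tagged_partial_division_ofD(2)[OF part])
          then show "?d K = dist (f (Inf K)) (f (Sup K))" by auto
        qed
        finally show ?thesis .
      qed
      ultimately have s1: "sum ?t p1 < e" by simp
      have "sum ?t (p - p1) \<le> (\<Sum>(x, K)\<in>p - p1. e * (Sup K - Inf K))"
      proof (rule sum_mono, clarify)
        fix x K assume xK: "(x, K) \<in> p" "(x, K) \<notin> p1"
        then have "x \<notin> N" by (auto simp: p1_def)
        obtain u v where K: "K = {u..v}" "u \<le> x" "x \<le> v" using ivl xK by blast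
        have "K \<subseteq> \<gamma> x" using fine xK(1) by (auto simp: fine_def)
        then have "K \<subseteq> ball x (r x)" using \<open>x \<notin> N\<close> by (simp add: \<gamma>_def)
        with R[OF \<open>x \<notin> N\<close> K(2,3)] K \<open>x \<notin> N\<close>
        show "norm (measure lborel K *\<^sub>R g x - (f (Sup K) - f (Inf K))) \<le> e * (Sup K - Inf K)"
          by (simp add: g_def)
      qed
      also have "\<dots> \<le> (\<Sum>(x, K)\<in>p. e * (Sup K - Inf K))"
      proof (rule sum_mono2[OF fin])
        show "p - p1 \<subseteq> p" by blast
        fix y assume y: "y \<in> p - (p - p1)"
        obtain x K where [simp]: "y = (x, K)" by force
        obtain u v where "K = {u..v}" "u \<le> x" "x \<le> v" using ivl y by auto blast
        then show "0 \<le> (case y of (x, K) \<Rightarrow> e * (Sup K - Inf K))" using e by simp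
      qed
      also have "\<dots> = e * (b - a)"
        unfolding ba(1) sum_distrib_left by (simp add: case_prod_unfold)
      finally have s2: "sum ?t (p - p1) \<le> e * (b - a)" .
      have "(\<Sum>(x, K)\<in>p. measure lborel K *\<^sub>R g x) - (f b - f a)
          = (\<Sum>(x, K)\<in>p. measure lborel K *\<^sub>R g x - (f (Sup K) - f (Inf K)))"
        unfolding ba(2) by (simp add: case_prod_unfold sum_subtractf)
      also have "norm \<dots> \<le> sum ?t p"
        by (rule order_trans[OF norm_sum]) (simp add: case_prod_unfold)
      also have "\<dots> = sum ?t (p - p1) + sum ?t p1"
        using sum.subset_diff[OF sub fin] by blast
      finally show ?thesis using s1 s2 eE by linarith
    qed
    ultimately show "\<exists>\<gamma>. gauge \<gamma> \<and> (\<forall>p. p tagged_division_of {a..b} \<and> \<gamma> fine p \<longrightarrow>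
        norm ((\<Sum>(x, K)\<in>p. measure lborel K *\<^sub>R g x) - (f b - f a)) < E)"
      by (intro exI[of _ \<gamma>]) simp
  qed
  moreover have "negligible N" using N by (simp add: negligible_iff_null_sets)
  ultimately show ?thesis
    using has_integral_spike[of N "{a..b}" h g] by (simp add: g_def)
qed

section \<open>Closure properties of absolute continuity\<close>

text \<open>Common source of the closure properties below. The constant \<open>B\<close> may depend
  on the compact interval, which is what admits products.\<close>

lemma locally_absolutely_continuous_dominated:
  fixes f :: "real \<Rightarrow> 'a::metric_space" and g :: "real \<Rightarrow> 'b::metric_space" and h :: "real \<Rightarrow> 'c::metric_space"
  assumes f: "locally_absolutely_continuous f" and g: "locally_absolutely_continuous g"
    and dom: "\<And>u v. \<exists>B. \<forall>x\<in>{u..v}. \<forall>y\<in>{u..v}. dist (h x) (h y) \<le> B * (dist (f x) (f y) + dist (g x) (g y))"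
  shows "locally_absolutely_continuous h"
  unfolding locally_absolutely_continuous_def
proof (intro allI impI)
  fix u v \<epsilon> :: real assume "\<epsilon> > 0"
  obtain B where B: "\<And>x y. x \<in> {u..v} \<Longrightarrow> y \<in> {u..v} \<Longrightarrow> dist (h x) (h y) \<le> B * (dist (f x) (f y) + dist (g x) (g y))"
    using dom by meson
  \<comment> \<open>The sums for \<open>f\<close> and \<open>g\<close> contribute \<open>e\<close>
    each, hence the 2. Using \<open>\<bar>B\<bar> + 1\<close> instead of \<open>B\<close> gives a
    positive factor whatever the sign of \<open>B\<close>.\<close>
  define e where "e = \<epsilon> / (2 * (\<bar>B\<bar> + 1))"
  have "e > 0" using \<open>\<epsilon> > 0\<close> by (simp add: e_def)
  obtain \<delta>1 where d1: "\<delta>1 > 0" and D1: "\<And>d. d division_of \<Union>d \<Longrightarrow> \<Union>d \<subseteq> {u..v} \<Longrightarrow>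
      (\<Sum>K\<in>d. Sup K - Inf K) < \<delta>1 \<Longrightarrow> (\<Sum>K\<in>d. dist (f (Inf K)) (f (Sup K))) < e"
    using locally_absolutely_continuousD[OF f \<open>e > 0\<close>, of u v] by blast
  obtain \<delta>2 where d2: "\<delta>2 > 0" and D2: "\<And>d. d division_of \<Union>d \<Longrightarrow> \<Union>d \<subseteq> {u..v} \<Longrightarrow>
      (\<Sum>K\<in>d. Sup K - Inf K) < \<delta>2 \<Longrightarrow> (\<Sum>K\<in>d. dist (g (Inf K)) (g (Sup K))) < e"
    using locally_absolutely_continuousD[OF g \<open>e > 0\<close>, of u v] by blast
  have "(\<Sum>K\<in>d. dist (h (Inf K)) (h (Sup K))) < \<epsilon>"
    if d: "d division_of \<Union>d" "\<Union>d \<subseteq> {u..v}" "(\<Sum>K\<in>d. Sup K - Inf K) < min \<delta>1 \<delta>2" for d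
  proof -
    let ?F = "\<Sum>K\<in>d. dist (f (Inf K)) (f (Sup K))" and ?G = "\<Sum>K\<in>d. dist (g (Inf K)) (g (Sup K))"
    have "(\<Sum>K\<in>d. dist (h (Inf K)) (h (Sup K)))
        \<le> (\<Sum>K\<in>d. (\<bar>B\<bar> + 1) * (dist (f (Inf K)) (f (Sup K)) + dist (g (Inf K)) (g (Sup K))))"
    proof (rule sum_mono)
      fix K assume K: "K \<in> d"
      obtain k l where kl: "K = cbox k l" using division_ofD(4)[OF d(1) K] by blast
      have "K \<noteq> {}" by (rule division_ofD(3)[OF d(1) K])
      then have "Inf K \<in> K" "Sup K \<in> K" using kl by auto
      then have "Inf K \<in> {u..v}" "Sup K \<in> {u..v}" using K d(2) by blast+
      then have "dist (h (Inf K)) (h (Sup K))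
          \<le> B * (dist (f (Inf K)) (f (Sup K)) + dist (g (Inf K)) (g (Sup K)))" by (rule B)
      also have "\<dots> \<le> (\<bar>B\<bar> + 1) * (dist (f (Inf K)) (f (Sup K)) + dist (g (Inf K)) (g (Sup K)))"
        by (intro mult_right_mono) auto
      finally show "dist (h (Inf K)) (h (Sup K)) \<le> \<dots>" .
    qed
    also have "\<dots> = (\<bar>B\<bar> + 1) * (?F + ?G)"
      by (simp add: sum_distrib_left[symmetric] sum.distrib)
    also have "\<dots> < (\<bar>B\<bar> + 1) * (e + e)"
      using D1[OF d(1,2)] D2[OF d(1,2)] d(3) by (intro mult_strict_left_mono add_strict_mono) auto
    also have "\<dots> = \<epsilon>"
      unfolding e_def by (simp add: divide_simps)
    finally show ?thesis .
  qed
  then show "\<exists>\<delta>>0. \<forall>d. d division_of \<Union>d \<and> \<Union>d \<subseteq> {u..v} \<and> (\<Sum>K\<in>d. Sup K - Inf K) < \<delta> \<longrightarrow>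
      (\<Sum>K\<in>d. dist (h (Inf K)) (h (Sup K))) < \<epsilon>"
    using d1 d2 by (intro exI[of _ "min \<delta>1 \<delta>2"]) auto
qed

lemma locally_absolutely_continuous_lipschitz:
  assumes "locally_absolutely_continuous f" "\<And>u v. dist (T u) (T v) \<le> dist u v"
  shows "locally_absolutely_continuous (\<lambda>x. T (f x))"
proof (rule locally_absolutely_continuous_dominated[OF assms(1) assms(1)])
  show "\<exists>B. \<forall>x\<in>{u..v}. \<forall>y\<in>{u..v}. dist (T (f x)) (T (f y)) \<le> B * (dist (f x) (f y) + dist (f x) (f y))" for u v
  proof (intro exI[of _ 1] ballI)
    fix x y
    show "dist (T (f x)) (T (f y)) \<le> 1 * (dist (f x) (f y) + dist (f x) (f y))"
      unfolding mult_1 by (rule add_increasing2[OF zero_le_dist assms(2)])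
  qed
qed

lemma locally_absolutely_continuous_diff:
  fixes f g :: "real \<Rightarrow> 'a::real_normed_vector"
  assumes "locally_absolutely_continuous f" "locally_absolutely_continuous g"
  shows "locally_absolutely_continuous (\<lambda>x. f x - g x)"
proof (rule locally_absolutely_continuous_dominated[OF assms])
  show "\<exists>B. \<forall>x\<in>{u..v}. \<forall>y\<in>{u..v}. dist (f x - g x) (f y - g y) \<le> B * (dist (f x) (f y) + dist (g x) (g y))" for u v
  proof (intro exI[of _ 1] ballI)
    fix x y
    have "f x - g x - (f y - g y) = (f x - f y) - (g x - g y)" by simp
    then show "dist (f x - g x) (f y - g y) \<le> 1 * (dist (f x) (f y) + dist (g x) (g y))"
      unfolding dist_norm mult_1 by (metis norm_triangle_ineq4)
  qed
qed

lemma continuous_on_Icc_norm_bounded: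
  fixes k :: "real \<Rightarrow> 'a::real_normed_vector"
  assumes "continuous_on {u..v} k"
  shows "\<exists>B. \<forall>x\<in>{u..v}. norm (k x) \<le> B"
  using compact_imp_bounded[OF compact_continuous_image[OF assms compact_Icc]]
  by (auto simp: bounded_iff)

text \<open>Both factors are continuous and therefore bounded on compact intervals, so the usual
  splitting of a difference of products gives a local domination.\<close>

lemma locally_absolutely_continuous_mult:
  fixes f g :: "real \<Rightarrow> 'a::real_normed_algebra"
  assumes f: "locally_absolutely_continuous f" and g: "locally_absolutely_continuous g"
  shows "locally_absolutely_continuous (\<lambda>x. f x * g x)"
proof (rule locally_absolutely_continuous_dominated[OF assms])
  fix u v :: real
  note bounded = continuous_on_Icc_norm_bounded[OF locally_absolutely_continuous_imp_continuous_on]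
  obtain F G
    where F: "\<And>x. x \<in> {u..v} \<Longrightarrow> norm (f x) \<le> F" and G: "\<And>x. x \<in> {u..v} \<Longrightarrow> norm (g x) \<le> G"
    using bounded[OF f] bounded[OF g] by metis
  define B where "B = max F G"
  have "dist (f x * g x) (f y * g y) \<le> B * (dist (f x) (f y) + dist (g x) (g y))"
    if "x \<in> {u..v}" "y \<in> {u..v}" for x y
  proof -
    have "f x * g x - f y * g y = f x * (g x - g y) + (f x - f y) * g y"
      by (simp add: algebra_simps)
    then have "norm (f x * g x - f y * g y) \<le> norm (f x) * norm (g x - g y) + norm (f x - f y) * norm (g y)"
      by (metis add_mono norm_mult_ineq norm_triangle_le)
    also have "\<dots> \<le> B * norm (g x - g y) + norm (f x - f y) * B"
      using F[OF that(1)] G[OF that(2)]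
      by (intro add_mono mult_right_mono mult_left_mono) (auto simp: B_def)
    finally show ?thesis by (simp add: dist_norm algebra_simps)
  qed
  then show "\<exists>B. \<forall>x\<in>{u..v}. \<forall>y\<in>{u..v}.
      dist (f x * g x) (f y * g y) \<le> B * (dist (f x) (f y) + dist (g x) (g y))" by blast
qed

subsection \<open>Eigenvectors of two-by-two matrices\<close>

text \<open>Here \<open>(e, b; c, -e)\<close> is the traceless part of a matrix and \<open>\<plusminus>s\<close> are its eigenvalues. The inner
  equations express the matrix through its eigenvectors.\<close>

lemma traceless_eigenvector_identity:
  fixes e b c s w1 w2 z1 z2 :: complex
  assumes w: "e * w1 + b * w2 = s * w1" "c * w1 - e * w2 = s * w2"
    and z: "e * z1 + b * z2 = - s * z1" "c * z1 - e * z2 = - s * z2"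
  defines "\<delta> \<equiv> w1 * z2 - w2 * z1"
  shows "(cmod \<delta>)\<^sup>2 * (2 * (cmod e)\<^sup>2 + (cmod b)\<^sup>2 + (cmod c)\<^sup>2 + 2 * (cmod s)\<^sup>2)
      = 4 * (cmod s)\<^sup>2 * (((cmod w1)\<^sup>2 + (cmod w2)\<^sup>2) * ((cmod z1)\<^sup>2 + (cmod z2)\<^sup>2))"
    and "(e\<^sup>2 + b * c - s\<^sup>2) * \<delta>\<^sup>2 = 0"
proof -
  have E: "e * \<delta> = s * (w1 * z2 + w2 * z1)"
    and Bb: "b * \<delta> = - 2 * s * (w1 * z1)"
    and C: "c * \<delta> = 2 * s * (w2 * z2)"
    unfolding \<delta>_def using w z by algebra+
  \<comment> \<open>Parallelogram law for \<open>w1 * z2\<close> and \<open>w2 * z1\<close>, whose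
    difference is \<open>\<delta>\<close>. It eliminates the mixed term that enters through
    \<open>e * \<delta>\<close>.\<close>
  have P: "(cmod (w1 * z2 + w2 * z1))\<^sup>2 + (cmod \<delta>)\<^sup>2 = 2 * ((cmod w1)\<^sup>2 * (cmod z2)\<^sup>2 + (cmod w2)\<^sup>2 * (cmod z1)\<^sup>2)"
    unfolding \<delta>_def cmod_power2 by (simp add: power2_eq_square algebra_simps)
  have "(cmod \<delta>)\<^sup>2 * (cmod e)\<^sup>2 = (cmod s)\<^sup>2 * (cmod (w1 * z2 + w2 * z1))\<^sup>2"
    using arg_cong[OF E, of cmod] by (metis norm_mult power_mult_distrib mult.commute)
  moreover have "cmod b * cmod \<delta> = 2 * (cmod s * (cmod w1 * cmod z1))"
    using arg_cong[OF Bb, of cmod] by (simp add: norm_mult)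
  then have "(cmod \<delta>)\<^sup>2 * (cmod b)\<^sup>2 = 4 * (cmod s)\<^sup>2 * ((cmod w1)\<^sup>2 * (cmod z1)\<^sup>2)"
    by algebra
  moreover have "cmod c * cmod \<delta> = 2 * (cmod s * (cmod w2 * cmod z2))"
    using arg_cong[OF C, of cmod] by (simp add: norm_mult)
  then have "(cmod \<delta>)\<^sup>2 * (cmod c)\<^sup>2 = 4 * (cmod s)\<^sup>2 * ((cmod w2)\<^sup>2 * (cmod z2)\<^sup>2)"
    by algebra
  ultimately show "(cmod \<delta>)\<^sup>2 * (2 * (cmod e)\<^sup>2 + (cmod b)\<^sup>2 + (cmod c)\<^sup>2 + 2 * (cmod s)\<^sup>2)
      = 4 * (cmod s)\<^sup>2 * (((cmod w1)\<^sup>2 + (cmod w2)\<^sup>2) * ((cmod z1)\<^sup>2 + (cmod z2)\<^sup>2))"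
    using P by algebra
  show "(e\<^sup>2 + b * c - s\<^sup>2) * \<delta>\<^sup>2 = 0"
    using E Bb C unfolding \<delta>_def by algebra
qed

text \<open>The discriminant of the characteristic polynomial, that is, the squared difference of
  the eigenvalues.\<close>

definition eigenvalue_discriminant :: "complex^2^2 \<Rightarrow> complex" where
  "eigenvalue_discriminant A = (trace A)\<^sup>2 - 4 * det A"

text \<open>The squared Frobenius norm of the traceless part of \<open>A\<close>.\<close>

definition deviator_sq :: "complex^2^2 \<Rightarrow> real" where
  "deviator_sq A = (cmod (A$1$1 - A$2$2))\<^sup>2 / 2 + (cmod (A$1$2))\<^sup>2 + (cmod (A$2$1))\<^sup>2"

lemma norm_vec2_sq: "(norm (w :: complex^2))\<^sup>2 = (cmod (w$1))\<^sup>2 + (cmod (w$2))\<^sup>2"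
  by (simp add: norm_vec_def L2_set_def sum_2)

lemma eigenvector_for_iff:
  "eigenvector_for A \<mu> w \<longleftrightarrow> w \<noteq> 0 \<and>
     A$1$1 * w$1 + A$1$2 * w$2 = \<mu> * w$1 \<and> A$2$1 * w$1 + A$2$2 * w$2 = \<mu> * w$2"
  by (simp add: eigenvector_for_def vec_eq_iff forall_2 matrix_vector_mult_def sum_2)

lemma eigenvalues_trace:
  assumes "\<mu> \<noteq> \<nu>" "eigenvector_for A \<mu> w" "eigenvector_for A \<nu> z"
  shows "w$1 * z$2 - w$2 * z$1 \<noteq> 0" "\<mu> + \<nu> = trace A"
proof -
  have ne: "w \<noteq> 0" "z \<noteq> 0"
    and W: "A$1$1 * w$1 + A$1$2 * w$2 = \<mu> * w$1" "A$2$1 * w$1 + A$2$2 * w$2 = \<mu> * w$2"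
    and Z: "A$1$1 * z$1 + A$1$2 * z$2 = \<nu> * z$1" "A$2$1 * z$1 + A$2$2 * z$2 = \<nu> * z$2"
    using assms(2,3) by (simp_all add: eigenvector_for_iff)
  show d: "w$1 * z$2 - w$2 * z$1 \<noteq> 0"
  proof
    assume "w$1 * z$2 - w$2 * z$1 = 0"
    then have *: "w$1 * z$2 = w$2 * z$1" by simp
    \<comment> \<open>For parallel vectors the right-hand sides vanish. Since the eigenvalues
      differ, \<open>w$1 * z$1\<close> and \<open>w$2 * z$2\<close> are then zero, and together with
      the parallelism this makes one of the vectors zero.\<close>
    have "(\<mu> - \<nu>) * (w$1 * z$1) = A$1$2 * (w$2 * z$1 - w$1 * z$2)"
      "(\<mu> - \<nu>) * (w$2 * z$2) = A$2$1 * (w$1 * z$2 - w$2 * z$1)"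
      using W Z by algebra+
    with * assms(1) have "w$1 * z$1 = 0" "w$2 * z$2 = 0" by auto
    with * have "w = 0 \<or> z = 0" by (auto simp: vec_eq_iff forall_2)
    then show False using ne by auto
  qed
  have "(\<mu> + \<nu> - (A$1$1 + A$2$2)) * (w$1 * z$2 - w$2 * z$1) = 0"
    using W Z by algebra
  then show "\<mu> + \<nu> = trace A" using d by (simp add: trace_def sum_2)
qed

text \<open>The right-hand side does not mention the eigenvectors. This gives the independence of
  their choice that the definite description in \<open>eigenvector_Gamma\<close> requires.\<close>

lemma eigenvector_angle_eq:
  assumes "\<mu> \<noteq> \<nu>" "eigenvector_for A \<mu> w" "eigenvector_for A \<nu> z"
  shows "cmod (det (transpose (vector [w, z]) :: complex^2^2)) / (norm w * norm z) =
    sqrt (cmod (eigenvalue_discriminant A) /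
      (deviator_sq A + cmod (eigenvalue_discriminant A) / 2))"
    (is "?l / _ = sqrt (?D / (?N + _))")
proof -
  have ne: "w \<noteq> 0" "z \<noteq> 0"
    and W: "A$1$1 * w$1 + A$1$2 * w$2 = \<mu> * w$1" "A$2$1 * w$1 + A$2$2 * w$2 = \<mu> * w$2"
    and Z: "A$1$1 * z$1 + A$1$2 * z$2 = \<nu> * z$1" "A$2$1 * z$1 + A$2$2 * z$2 = \<nu> * z$2"
    using assms(2,3) by (simp_all add: eigenvector_for_iff)
  note tr = eigenvalues_trace[OF assms]
  define \<delta> where "\<delta> = w$1 * z$2 - w$2 * z$1"
  \<comment> \<open>Subtracting half the trace from \<open>A\<close> reduces to the traceless case:
    \<open>e\<close> is the upper diagonal entry that remains, and the eigenvalues become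
    \<open>s\<close> and \<open>- s\<close> because \<open>\<mu> + \<nu>\<close> is the
    trace.\<close>
  define e where "e = (A$1$1 - A$2$2) / 2"
  define s where "s = (\<mu> - \<nu>) / 2"
  have tr2: "\<mu> + \<nu> = A$1$1 + A$2$2" using tr by (simp add: trace_def sum_2)
  define t where "t = (A$1$1 + A$2$2) / 2"
  have A: "A$1$1 = t + e" "A$2$2 = t - e" "\<mu> = t + s" "\<nu> = t - s"
    unfolding e_def t_def s_def by (simp_all add: tr2[symmetric] add_divide_distrib diff_divide_distrib)
      (simp_all add: tr2 add_divide_distrib[symmetric] diff_divide_distrib[symmetric])
  have eq: "e * w$1 + A$1$2 * w$2 = s * w$1" "A$2$1 * w$1 - e * w$2 = s * w$2"
    "e * z$1 + A$1$2 * z$2 = - s * z$1" "A$2$1 * z$1 - e * z$2 = - s * z$2"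
    using W Z unfolding A by algebra+
  note I = traceless_eigenvector_identity[OF eq, folded \<delta>_def]
  have "e\<^sup>2 + A$1$2 * A$2$1 = s\<^sup>2" using I(2) tr(1) by (simp add: \<delta>_def)
  then have "eigenvalue_discriminant A = 4 * s\<^sup>2"
    unfolding eigenvalue_discriminant_def e_def
    by (simp add: trace_def sum_2 det_2 field_simps power2_eq_square)
  then have D: "?D = 4 * (cmod s)\<^sup>2" by (simp add: norm_mult norm_power)
  have N: "2 * (cmod e)\<^sup>2 + (cmod (A$1$2))\<^sup>2 + (cmod (A$2$1))\<^sup>2 = ?N"
    by (simp add: deviator_sq_def e_def norm_divide power_divide)
  have "det (transpose (vector [w, z]) :: complex^2^2) = \<delta>"
    by (simp add: det_2 transpose_def \<delta>_def algebra_simps)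
  moreover have "(cmod \<delta>)\<^sup>2 * (?N + ?D / 2) = ?D * (norm w * norm z)\<^sup>2"
    using I(1) unfolding N D power_mult_distrib norm_vec2_sq by simp
  moreover have "?D > 0" using D assms(1) by (simp add: s_def)
  moreover from this have "?N + ?D / 2 > 0"
    by (intro add_nonneg_pos) (simp_all add: deviator_sq_def)
  moreover have "norm w * norm z > 0" using ne by simp
  ultimately have "(?l / (norm w * norm z))\<^sup>2 = ?D / (?N + ?D / 2)"
    by (subst power_divide, subst frac_eq_eq) auto
  then show ?thesis using \<open>norm w * norm z > 0\<close> by (metis divide_nonneg_pos norm_ge_zero real_sqrt_unique)
qed

text \<open>The hypotheses say that \<open>\<mu>\<close> is a root of the characteristic polynomial
  and that it is simple. A vector annihilated by a nonzero row of \<open>A - \<mu>\<close> is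
  annihilated by the other row too, as the determinant is zero. If the first row vanishes, the
  second is used, and simplicity makes the first component of the witness nonzero.\<close>

lemma eigenvector_exists:
  fixes A :: "complex^2^2"
  assumes "(A$1$1 - \<mu>) * (A$2$2 - \<mu>) = A$1$2 * A$2$1"
    and "A$1$1 + A$2$2 \<noteq> 2 * \<mu>"
  shows "\<exists>w. eigenvector_for A \<mu> w"
proof (cases "A$1$2 = 0 \<and> A$1$1 = \<mu>")
  case True
  have "eigenvector_for A \<mu> (vector [\<mu> - A$2$2, A$2$1])"
    using assms True by (auto simp: eigenvector_for_iff vec_eq_iff forall_2 algebra_simps)
  then show ?thesis by blast
next
  case False
  have "eigenvector_for A \<mu> (vector [A$1$2, \<mu> - A$1$1])"
    using assms(1) False by (auto simp: eigenvector_for_iff vec_eq_iff forall_2 algebra_simps)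
  then show ?thesis by blast
qed

text \<open>The quadratic formula supplies two distinct eigenvalues, so the definite description has
  a candidate; uniqueness is \<open>eigenvector_angle_eq\<close>.\<close>

theorem eigenvector_Gamma_eq:
  assumes "eigenvalue_discriminant A \<noteq> 0"
  shows "eigenvector_Gamma A =
    sqrt (cmod (eigenvalue_discriminant A) /
      (deviator_sq A + cmod (eigenvalue_discriminant A) / 2))"
proof -
  define s where "s = csqrt (eigenvalue_discriminant A)"
  have s2: "s\<^sup>2 = (A$1$1 + A$2$2)\<^sup>2 - 4 * (A$1$1 * A$2$2 - A$1$2 * A$2$1)"
    by (simp add: s_def eigenvalue_discriminant_def trace_def sum_2 det_2)
  have "s \<noteq> 0" using assms by (simp add: s_def)
  define \<mu> where "\<mu> = (trace A + s) / 2"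
  define \<nu> where "\<nu> = (trace A - s) / 2"
  have "\<exists>w. eigenvector_for A \<mu> w" "\<exists>w. eigenvector_for A \<nu> w"
    using s2 \<open>s \<noteq> 0\<close>
    by (auto intro!: eigenvector_exists
        simp: \<mu>_def \<nu>_def trace_def sum_2 field_simps power2_eq_square)
  moreover have "\<mu> \<noteq> \<nu>" using \<open>s \<noteq> 0\<close> by (simp add: \<mu>_def \<nu>_def)
  ultimately obtain w z where "eigenvector_for A \<mu> w" "eigenvector_for A \<nu> z" "\<mu> \<noteq> \<nu>" by blast
  then show ?thesis
    unfolding eigenvector_Gamma_def
    by (intro the_equality) (use eigenvector_angle_eq in metis)+
qed

subsection \<open>The Dirac system\<close>

text \<open>One column of a matrix solution as a scalar system solved for the derivatives;
  \<open>f\<close> is the upper component and \<open>g\<close> the lower one.\<close>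

definition dirac_pair :: "real \<Rightarrow> (real \<Rightarrow> real) \<Rightarrow> complex \<Rightarrow> (real \<Rightarrow> complex) \<Rightarrow> (real \<Rightarrow> complex) \<Rightarrow> bool" where
  "dirac_pair m q lam f g \<longleftrightarrow>
     locally_absolutely_continuous f \<and> locally_absolutely_continuous g \<and>
     (AE x in lebesgue.
        (f has_vector_derivative (lam + of_real m - of_real (q x)) * g x) (at x) \<and>
        (g has_vector_derivative (of_real m + of_real (q x) - lam) * f x) (at x))"

lemma dirac_solution_column:
  assumes "dirac_solution m q lam Y"
  shows "dirac_pair m q lam (\<lambda>x. Y x $ 1 $ j) (\<lambda>x. Y x $ 2 $ j)"
  unfolding dirac_pair_def
proof (intro conjI)
  have ac: "locally_absolutely_continuous Y"
    and ae: "AE x in lebesgue. \<exists>Y'. (Y has_vector_derivative Y') (at x) \<and>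
        mat (- \<i>) ** sigma2 ** Y'
          + (mat (complex_of_real m) ** sigma3 + mat (complex_of_real (q x))) ** Y x
        = mat lam ** Y x"
    using assms by (auto simp: dirac_solution_def)
  have "locally_absolutely_continuous (\<lambda>x. Y x $ i $ j)" for i
    by (rule locally_absolutely_continuous_lipschitz[OF ac, of "\<lambda>A. A $ i $ j"])
      (meson dist_vec_nth_le order_trans)
  then show "locally_absolutely_continuous (\<lambda>x. Y x $ 1 $ j)"
    "locally_absolutely_continuous (\<lambda>x. Y x $ 2 $ j)" by blast+
  show "AE x in lebesgue.
        ((\<lambda>x. Y x $ 1 $ j) has_vector_derivative (lam + of_real m - of_real (q x)) * (Y x $ 2 $ j)) (at x) \<and>
        ((\<lambda>x. Y x $ 2 $ j) has_vector_derivative (of_real m + of_real (q x) - lam) * (Y x $ 1 $ j)) (at x)"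
    using ae
  proof (rule AE_mp, intro AE_I2 impI)
    fix x assume "\<exists>Y'. (Y has_vector_derivative Y') (at x) \<and>
        mat (- \<i>) ** sigma2 ** Y'
          + (mat (complex_of_real m) ** sigma3 + mat (complex_of_real (q x))) ** Y x
        = mat lam ** Y x"
    then obtain Y' where Y': "(Y has_vector_derivative Y') (at x)"
      and eq: "mat (- \<i>) ** sigma2 ** Y'
          + (mat (complex_of_real m) ** sigma3 + mat (complex_of_real (q x))) ** Y x
        = mat lam ** Y x" by blast
    have d: "((\<lambda>x. Y x $ i $ j) has_vector_derivative Y' $ i $ j) (at x)" for i
      using bounded_linear.has_vector_derivative[OF bounded_linear_compose[OF bounded_linear_vec_nth bounded_linear_vec_nth] Y'] .
    have "(mat (- \<i>) ** sigma2 ** Y'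
          + (mat (complex_of_real m) ** sigma3 + mat (complex_of_real (q x))) ** Y x) $ i $ j
        = (mat lam ** Y x) $ i $ j" for i using eq by simp
    from this[of 1] this[of 2]
    \<comment> \<open>The product \<open>mat (- \<i>) ** sigma2\<close> is the real matrix with rows
      (0, -1) and (1, 0), so each row of the equation determines the derivative of the other
      component.\<close>
    have "- Y' $ 2 $ j + (of_real m + of_real (q x)) * (Y x $ 1 $ j) = lam * (Y x $ 1 $ j)"
      "Y' $ 1 $ j + (- of_real m + of_real (q x)) * (Y x $ 2 $ j) = lam * (Y x $ 2 $ j)"
      by (simp_all add: matrix_matrix_mult_def sum_2 mat_def sigma2_def sigma3_def)
    then have "Y' $ 1 $ j = (lam + of_real m - of_real (q x)) * (Y x $ 2 $ j)"
      "Y' $ 2 $ j = (of_real m + of_real (q x) - lam) * (Y x $ 1 $ j)"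
      by algebra+
    then show "((\<lambda>x. Y x $ 1 $ j) has_vector_derivative (lam + of_real m - of_real (q x)) * (Y x $ 2 $ j)) (at x) \<and>
        ((\<lambda>x. Y x $ 2 $ j) has_vector_derivative (of_real m + of_real (q x) - lam) * (Y x $ 1 $ j)) (at x)"
      using d[of 1] d[of 2] by simp
  qed
qed

lemma dirac_pair_continuous_on:
  assumes "dirac_pair m q lam f g"
  shows "continuous_on {s..t} f" "continuous_on {s..t} g"
  using assms by (auto simp: dirac_pair_def intro: locally_absolutely_continuous_imp_continuous_on)

text \<open>At a real spectral parameter all coefficients of the system are real.\<close>

lemma dirac_pair_cnj:
  assumes "dirac_pair m q (of_real lam) f g"
  shows "dirac_pair m q (of_real lam) (\<lambda>x. cnj (f x)) (\<lambda>x. cnj (g x))"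
proof -
  have lip: "dist (cnj u) (cnj v) \<le> dist u v" for u v
    by (metis complex_cnj_diff complex_mod_cnj dist_norm order_refl)
  have "((\<lambda>x. cnj (k x)) has_vector_derivative cnj k') (at x)" if "(k has_vector_derivative k') (at x)" for k k' x
    by (rule bounded_linear.has_vector_derivative[OF bounded_linear_cnj that])
  note d = this
  have "AE x in lebesgue.
      ((\<lambda>x. cnj (f x)) has_vector_derivative (of_real lam + of_real m - of_real (q x)) * cnj (g x)) (at x) \<and>
      ((\<lambda>x. cnj (g x)) has_vector_derivative (of_real m + of_real (q x) - of_real lam) * cnj (f x)) (at x)"
    using conjunct2[OF conjunct2[OF assms[unfolded dirac_pair_def]]]
  proof (rule AE_mp, intro AE_I2 impI)
    fix x assume "(f has_vector_derivative (of_real lam + of_real m - of_real (q x)) * g x) (at x) \<and>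
      (g has_vector_derivative (of_real m + of_real (q x) - of_real lam) * f x) (at x)"
    then show "((\<lambda>x. cnj (f x)) has_vector_derivative (of_real lam + of_real m - of_real (q x)) * cnj (g x)) (at x) \<and>
      ((\<lambda>x. cnj (g x)) has_vector_derivative (of_real m + of_real (q x) - of_real lam) * cnj (f x)) (at x)"
      using d[of f _ x] d[of g _ x] by fastforce
  qed
  then show ?thesis
    using assms unfolding dirac_pair_def
    by (auto intro: locally_absolutely_continuous_lipschitz[where T = cnj] lip)
qed

text \<open>On differentiating the Wronskian all terms with \<open>m\<close> and \<open>q\<close>
  cancel. Only the difference of the spectral parameters survives, with an integrand free of
  \<open>q\<close>.\<close>

lemma dirac_wronskian_has_integral:
  assumes "dirac_pair m q lam f g" "dirac_pair m q mu u v" "s \<le> t"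
  shows "((\<lambda>x. (mu - lam) * (f x * u x + g x * v x)) has_integral
      ((g t * u t - f t * v t) - (g s * u s - f s * v s))) {s..t}"
proof (rule fundamental_theorem_of_calculus_absolutely_continuous[OF _ _ assms(3)])
  show "locally_absolutely_continuous (\<lambda>x. g x * u x - f x * v x)"
    using assms(1,2) unfolding dirac_pair_def
    by (intro locally_absolutely_continuous_diff locally_absolutely_continuous_mult) auto
  have "AE x in lebesgue.
        ((f has_vector_derivative (lam + of_real m - of_real (q x)) * g x) (at x) \<and>
        (g has_vector_derivative (of_real m + of_real (q x) - lam) * f x) (at x)) \<and>
        ((u has_vector_derivative (mu + of_real m - of_real (q x)) * v x) (at x) \<and>
        (v has_vector_derivative (of_real m + of_real (q x) - mu) * u x) (at x))"
    using assms(1,2) unfolding dirac_pair_def by (intro AE_conjI) auto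
  then show "AE x in lebesgue. ((\<lambda>x. g x * u x - f x * v x) has_vector_derivative
      (mu - lam) * (f x * u x + g x * v x)) (at x)"
  proof (rule AE_mp, intro AE_I2 impI)
    fix x assume *: "((f has_vector_derivative (lam + of_real m - of_real (q x)) * g x) (at x) \<and>
        (g has_vector_derivative (of_real m + of_real (q x) - lam) * f x) (at x)) \<and>
        ((u has_vector_derivative (mu + of_real m - of_real (q x)) * v x) (at x) \<and>
        (v has_vector_derivative (of_real m + of_real (q x) - mu) * u x) (at x))"
    show "((\<lambda>x. g x * u x - f x * v x) has_vector_derivative (mu - lam) * (f x * u x + g x * v x)) (at x)"
      by (rule has_vector_derivative_eq_rhs)
        (rule has_vector_derivative_diff has_vector_derivative_mult conjunct1[OF conjunct1[OF *]]
          conjunct2[OF conjunct1[OF *]] conjunct1[OF conjunct2[OF *]] conjunct2[OF conjunct2[OF *]]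
        | simp add: algebra_simps)+
  qed
qed

section \<open>A semidefinite form in the Gram matrix of two real solutions\<close>

text \<open>By \<open>disc\<close> the coefficients form a matrix of rank one. Up to a nonzero
  factor the expression is thus the integral of the squared length of one combination of the two
  solutions with coefficients \<open>k\<close>, \<open>l\<close>, not both zero. At 0 this squared
  length is \<open>k\<^sup>2 + l\<^sup>2\<close>, so by continuity its integral is not zero.\<close>

lemma gram_form_nonzero:
  fixes P1 P2 R1 R2 :: "real \<Rightarrow> real"
  assumes "a > 0" "continuous_on {0..a} P1" "continuous_on {0..a} P2"
      "continuous_on {0..a} R1" "continuous_on {0..a} R2"
    and init: "P1 0 = 1" "P2 0 = 0" "R1 0 = 0" "R2 0 = 1"
    and disc: "(\<alpha> - \<delta>)\<^sup>2 + 4 * \<beta> * \<gamma> = 0" and ne: "\<beta> \<noteq> 0 \<or> \<gamma> \<noteq> 0"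
  shows "(\<alpha> - \<delta>) * integral {0..a} (\<lambda>t. P1 t * R1 t + P2 t * R2 t)
      - \<beta> * integral {0..a} (\<lambda>t. P1 t * P1 t + P2 t * P2 t)
      + \<gamma> * integral {0..a} (\<lambda>t. R1 t * R1 t + R2 t * R2 t) \<noteq> 0"
    (is "_ * ?PR - _ * ?PP + _ * ?RR \<noteq> 0")
proof -
  note cont = assms(2-5)
  have form: "k\<^sup>2 * ?PP + 2 * k * l * ?PR + l\<^sup>2 * ?RR \<noteq> 0" if kl: "k \<noteq> 0 \<or> l \<noteq> 0" for k l :: real
  proof -
    define F where "F t = (k * P1 t + l * R1 t)\<^sup>2 + (k * P2 t + l * R2 t)\<^sup>2" for t
    have contF: "continuous_on {0..a} F"
      unfolding F_def by (intro continuous_intros cont)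
    have "F 0 \<noteq> 0" using kl by (simp add: F_def init sum_power2_eq_zero_iff)
    then have "integral {0..a} F \<noteq> 0"
      using integral_eq_0_iff[OF contF \<open>a > 0\<close>] \<open>a > 0\<close> by (auto simp: F_def)
    moreover have "(F has_integral (k\<^sup>2 * ?PP + 2 * k * l * ?PR + l\<^sup>2 * ?RR)) {0..a}"
    proof -
      have "F = (\<lambda>t. k\<^sup>2 * (P1 t * P1 t + P2 t * P2 t) + 2 * k * l * (P1 t * R1 t + P2 t * R2 t)
          + l\<^sup>2 * (R1 t * R1 t + R2 t * R2 t))"
        by (auto simp: F_def power2_eq_square algebra_simps)
      then show ?thesis
        by (simp only:) (intro has_integral_add has_integral_mult_right integrable_integral
            integrable_continuous_real continuous_intros cont)
    qed
    ultimately show ?thesis by (metis integral_unique)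
  qed
  show ?thesis
  proof (cases "\<beta> = 0")
    case True
    \<comment> \<open>Here \<open>disc\<close> forces \<open>\<alpha> = \<delta>\<close>, so only
      the term with \<open>\<gamma>\<close> is left.\<close>
    then show ?thesis using disc ne form[of 0 1] by simp
  next
    case False
    have "(2 * \<beta>)\<^sup>2 * ?PP + 2 * (2 * \<beta>) * (\<delta> - \<alpha>) * ?PR + (\<delta> - \<alpha>)\<^sup>2 * ?RR
        = - 4 * \<beta> * ((\<alpha> - \<delta>) * ?PR - \<beta> * ?PP + \<gamma> * ?RR)"
      using disc by algebra
    then show ?thesis using form[of "2 * \<beta>" "\<delta> - \<alpha>"] False by auto
  qed
qed

section \<open>Dependence of solutions on the spectral parameter\<close>

text \<open>The pairs \<open>p\<close> and \<open>r\<close> are the two columns of the fundamental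
  solution at the base point \<open>lam\<close>; solutions at other parameters \<open>mu\<close> are
  compared with them.\<close>

locale dirac_basis =
  fixes m :: real and q :: "real \<Rightarrow> real" and lam :: complex and p1 p2 r1 r2 :: "real \<Rightarrow> complex"
  assumes p: "dirac_pair m q lam p1 p2" and r: "dirac_pair m q lam r1 r2"
    and init: "p1 0 = 1" "p2 0 = 0" "r1 0 = 0" "r2 0 = 1"
begin

text \<open>For equal spectral parameters the integrand of the Wronskian identity is zero, so the
  Wronskian keeps its initial value.\<close>

lemma det_eq_1:
  assumes "0 \<le> x"
  shows "p1 x * r2 x - p2 x * r1 x = 1"
proof -
  have "((\<lambda>x. 0) has_integral ((p2 x * r1 x - p1 x * r2 x) - (p2 0 * r1 0 - p1 0 * r2 0))) {0..x}"
    using dirac_wronskian_has_integral[OF p r assms] by simp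
  then have "(p2 x * r1 x - p1 x * r2 x) - (p2 0 * r1 0 - p1 0 * r2 0) = 0"
    using has_integral_0 has_integral_unique by blast
  then show ?thesis by (simp add: init algebra_simps)
qed

text \<open>Variation of constants, read off from the Wronskians of \<open>u\<close> with the two basis solutions.\<close>

lemma representation:
  assumes u: "dirac_pair m q mu u1 u2" and "0 \<le> x"
  defines "Ip \<equiv> integral {0..x} (\<lambda>t. p1 t * u1 t + p2 t * u2 t)"
    and "Ir \<equiv> integral {0..x} (\<lambda>t. r1 t * u1 t + r2 t * u2 t)"
  shows "u1 x = u1 0 * p1 x + u2 0 * r1 x + (mu - lam) * (p1 x * Ir - r1 x * Ip)"
    and "u2 x = u1 0 * p2 x + u2 0 * r2 x + (mu - lam) * (p2 x * Ir - r2 x * Ip)"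
proof -
  have W: "(g x * u1 x - f x * u2 x) - (g 0 * u1 0 - f 0 * u2 0)
      = (mu - lam) * integral {0..x} (\<lambda>t. f t * u1 t + g t * u2 t)"
    if fg: "dirac_pair m q lam f g" for f g
  proof -
    have "(\<lambda>t. f t * u1 t + g t * u2 t) integrable_on {0..x}"
      by (intro integrable_continuous_real continuous_intros
          dirac_pair_continuous_on[OF u] dirac_pair_continuous_on[OF fg])
    then have "((\<lambda>t. (mu - lam) * (f t * u1 t + g t * u2 t)) has_integral
        (mu - lam) * integral {0..x} (\<lambda>t. f t * u1 t + g t * u2 t)) {0..x}"
      by (intro has_integral_mult_right integrable_integral)
    with dirac_wronskian_has_integral[OF fg u \<open>0 \<le> x\<close>] show ?thesis
      by (rule has_integral_unique)
  qed
  have P: "p2 x * u1 x - p1 x * u2 x + u2 0 = (mu - lam) * Ip"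
    using W[OF p] by (simp add: init Ip_def)
  have R: "r2 x * u1 x - r1 x * u2 x - u1 0 = (mu - lam) * Ir"
    using W[OF r] by (simp add: init Ir_def)
  \<comment> \<open>\<open>P\<close> and \<open>R\<close> are linear equations for
    \<open>u1 x\<close> and \<open>u2 x\<close> with determinant 1 by \<open>D\<close>; solving them
    is Cramer's rule.\<close>
  have D: "p1 x * r2 x - p2 x * r1 x = 1" using \<open>0 \<le> x\<close> by (rule det_eq_1)
  show "u1 x = u1 0 * p1 x + u2 0 * r1 x + (mu - lam) * (p1 x * Ir - r1 x * Ip)"
    using P R D by algebra
  show "u2 x = u1 0 * p2 x + u2 0 * r2 x + (mu - lam) * (p2 x * Ir - r2 x * Ip)"
    using P R D by algebra
qed

lemma solution_bounds:
  assumes "a > 0"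
  obtains C where "C > 0"
    "\<And>x. x \<in> {0..a} \<Longrightarrow> cmod (p1 x) \<le> C \<and> cmod (p2 x) \<le> C \<and> cmod (r1 x) \<le> C \<and> cmod (r2 x) \<le> C"
proof -
  note bounded = continuous_on_Icc_norm_bounded[where u = 0 and v = a]
  note B = bounded[OF dirac_pair_continuous_on(1)[OF p]] bounded[OF dirac_pair_continuous_on(2)[OF p]]
    bounded[OF dirac_pair_continuous_on(1)[OF r]] bounded[OF dirac_pair_continuous_on(2)[OF r]]
  obtain B1 where B1: "\<forall>x\<in>{0..a}. cmod (p1 x) \<le> B1" using B(1) by blast
  obtain B2 where B2: "\<forall>x\<in>{0..a}. cmod (p2 x) \<le> B2" using B(2) by blast
  obtain B3 where B3: "\<forall>x\<in>{0..a}. cmod (r1 x) \<le> B3" using B(3) by blast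
  obtain B4 where B4: "\<forall>x\<in>{0..a}. cmod (r2 x) \<le> B4" using B(4) by blast
  define C where "C = \<bar>B1\<bar> + \<bar>B2\<bar> + \<bar>B3\<bar> + \<bar>B4\<bar> + 1"
  have "C > 0" unfolding C_def by linarith
  moreover have "cmod (p1 x) \<le> C \<and> cmod (p2 x) \<le> C \<and> cmod (r1 x) \<le> C \<and> cmod (r2 x) \<le> C"
    if "x \<in> {0..a}" for x
    using bspec[OF B1 that] bspec[OF B2 that] bspec[OF B3 that] bspec[OF B4 that]
    unfolding C_def by (intro conjI) linarith+
  ultimately show thesis using that by blast
qed

text \<open>\<open>C\<close> bounds the known solutions. \<open>S\<close> bounds the factor under
  study: the perturbed solution itself in \<open>perturbation\<close>, and later its deviation from
  the unperturbed one.\<close>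

lemma norm_pair_integral_le:
  assumes "continuous_on {0..a} f" "continuous_on {0..a} g"
    and "continuous_on {0..a} v1" "continuous_on {0..a} v2"
    and f: "\<And>x. x \<in> {0..a} \<Longrightarrow> cmod (f x) \<le> C \<and> cmod (g x) \<le> C"
    and v: "\<And>x. x \<in> {0..a} \<Longrightarrow> cmod (v1 x) + cmod (v2 x) \<le> S"
    and x: "x \<in> {0..a}"
  shows "cmod (integral {0..x} (\<lambda>t. f t * v1 t + g t * v2 t)) \<le> C * S * a"
proof -
  have sub: "{0..x} \<subseteq> {0..a}" using x by auto
  have "0 \<in> {0..a}" using x by auto
  then have C: "0 \<le> C" "0 \<le> S" using f[of 0] v[of 0] norm_ge_zero[of "f 0"] norm_ge_zero[of "v1 0"]
      norm_ge_zero[of "v2 0"]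
    by linarith+
  have "cmod (integral {0..x} (\<lambda>t. f t * v1 t + g t * v2 t)) \<le> C * S * (x - 0)"
  proof (rule integral_bound)
    show "0 \<le> x" using x by auto
    show "continuous_on {0..x} (\<lambda>t. f t * v1 t + g t * v2 t)"
      by (intro continuous_intros continuous_on_subset[OF _ sub] assms(1-4))
    fix t assume "t \<in> {0..x}"
    then have t: "t \<in> {0..a}" using sub by blast
    have "cmod (f t * v1 t + g t * v2 t) \<le> cmod (f t) * cmod (v1 t) + cmod (g t) * cmod (v2 t)"
      by (metis norm_mult norm_triangle_ineq)
    also have "\<dots> \<le> C * cmod (v1 t) + C * cmod (v2 t)"
      using f[OF t] by (intro add_mono mult_right_mono) auto
    also have "\<dots> \<le> C * S"
      using v[OF t] C by (metis distrib_left mult_left_mono)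
    finally show "cmod (f t * v1 t + g t * v2 t) \<le> C * S" .
  qed
  also have "\<dots> \<le> C * S * a"
    using x C by (intro mult_left_mono) auto
  finally show ?thesis .
qed

text \<open>The supremum of \<open>u\<close> appears on both sides of the representation with a small factor on the
  right, so it is absorbed; no Gronwall estimate is needed.\<close>

lemma perturbation:
  assumes u: "dirac_pair m q mu u1 u2" and "a > 0"
    and C: "\<And>x. x \<in> {0..a} \<Longrightarrow> cmod (p1 x) \<le> C \<and> cmod (p2 x) \<le> C \<and> cmod (r1 x) \<le> C \<and> cmod (r2 x) \<le> C"
    and u0: "cmod (u1 0) + cmod (u2 0) \<le> 1"
    and small: "cmod (mu - lam) * (8 * C\<^sup>2 * a) \<le> 1"
    and x: "x \<in> {0..a}"
  shows "cmod (u1 x - (u1 0 * p1 x + u2 0 * r1 x)) \<le> 8 * C^3 * a * cmod (mu - lam)"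
    and "cmod (u2 x - (u1 0 * p2 x + u2 0 * r2 x)) \<le> 8 * C^3 * a * cmod (mu - lam)"
proof -
  note cont = dirac_pair_continuous_on[OF p, of 0 a] dirac_pair_continuous_on[OF r, of 0 a]
    dirac_pair_continuous_on[OF u, of 0 a]
  define e where "e = cmod (mu - lam)"
  have C0: "0 \<le> C" using C[of 0] \<open>a > 0\<close> by (simp add: init)
  \<comment> \<open>The supremum \<open>S\<close> of the solution is attained at some
    \<open>x0\<close>, so it is finite and obeys the estimate \<open>diff\<close> at that
    point.\<close>
  have "continuous_on {0..a} (\<lambda>x. cmod (u1 x) + cmod (u2 x))"
    by (intro continuous_intros cont)
  then obtain x0 where x0: "x0 \<in> {0..a}"
    and "\<And>y. y \<in> {0..a} \<Longrightarrow> cmod (u1 y) + cmod (u2 y) \<le> cmod (u1 x0) + cmod (u2 x0)"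
    using continuous_attains_sup[of "{0..a}" "\<lambda>x. cmod (u1 x) + cmod (u2 x)"] \<open>a > 0\<close> by auto
  moreover define S where "S = cmod (u1 x0) + cmod (u2 x0)"
  ultimately have S: "\<And>y. y \<in> {0..a} \<Longrightarrow> cmod (u1 y) + cmod (u2 y) \<le> S" by simp
  have term_le: "cmod (k * J - l * I) \<le> 2 * C * (C * S * a)"
    if "cmod k \<le> C" "cmod l \<le> C" "cmod I \<le> C * S * a" "cmod J \<le> C * S * a" for k l I J
  proof -
    have "cmod (k * J - l * I) \<le> cmod k * cmod J + cmod l * cmod I"
      by (metis norm_mult norm_triangle_ineq4)
    also have "\<dots> \<le> C * (C * S * a) + C * (C * S * a)"
      using that C0 by (intro add_mono mult_mono) auto
    finally show ?thesis by simp
  qed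
  have diff: "cmod (u1 y - (u1 0 * p1 y + u2 0 * r1 y)) \<le> e * (2 * C\<^sup>2 * a) * S \<and>
      cmod (u2 y - (u1 0 * p2 y + u2 0 * r2 y)) \<le> e * (2 * C\<^sup>2 * a) * S" if y: "y \<in> {0..a}" for y
  proof -
    have y0: "0 \<le> y" using y by simp
    let ?Ip = "integral {0..y} (\<lambda>t. p1 t * u1 t + p2 t * u2 t)"
      and ?Ir = "integral {0..y} (\<lambda>t. r1 t * u1 t + r2 t * u2 t)"
    have I: "cmod ?Ip \<le> C * S * a" "cmod ?Ir \<le> C * S * a"
      by (intro norm_pair_integral_le cont S y; use C in blast)+
    have eq: "e * (2 * C\<^sup>2 * a) * S = e * (2 * C * (C * S * a))"
      by (simp add: power2_eq_square)
    have "u1 y - (u1 0 * p1 y + u2 0 * r1 y) = (mu - lam) * (p1 y * ?Ir - r1 y * ?Ip)"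
      "u2 y - (u1 0 * p2 y + u2 0 * r2 y) = (mu - lam) * (p2 y * ?Ir - r2 y * ?Ip)"
      using representation[OF u y0] by simp_all
    then show ?thesis
      unfolding eq unfolding e_def using C[OF y] I by (auto simp: norm_mult intro!: mult_left_mono term_le)
  qed
  \<comment> \<open>At \<open>x0\<close> each unperturbed component is at most \<open>C\<close> and
    the two errors add up to at most \<open>S / 2\<close> by \<open>small\<close>. Hence
    \<open>S \<le> 2 * C + S / 2\<close>, and inserting \<open>S \<le> 4 * C\<close> into
    \<open>diff\<close> produces the constant \<open>8 * C^3 * a\<close>.\<close>
  have S4: "S \<le> 4 * C"
  proof -
    have base: "cmod (u1 0 * k + u2 0 * l) \<le> C" if "cmod k \<le> C" "cmod l \<le> C" for k l
    proof -
      have "cmod (u1 0 * k + u2 0 * l) \<le> cmod (u1 0) * cmod k + cmod (u2 0) * cmod l"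
        by (metis norm_mult norm_triangle_ineq)
      also have "\<dots> \<le> cmod (u1 0) * C + cmod (u2 0) * C"
        using that by (intro add_mono mult_left_mono) auto
      also have "\<dots> \<le> 1 * C"
        unfolding distrib_right[symmetric] using u0 C0 by (rule mult_right_mono)
      finally show ?thesis by simp
    qed
    have "cmod (u1 x0) \<le> cmod (u1 x0 - (u1 0 * p1 x0 + u2 0 * r1 x0)) + cmod (u1 0 * p1 x0 + u2 0 * r1 x0)"
      "cmod (u2 x0) \<le> cmod (u2 x0 - (u1 0 * p2 x0 + u2 0 * r2 x0)) + cmod (u1 0 * p2 x0 + u2 0 * r2 x0)"
      by (metis diff_add_cancel norm_triangle_ineq)+
    moreover have "cmod (u1 0 * p1 x0 + u2 0 * r1 x0) \<le> C" "cmod (u1 0 * p2 x0 + u2 0 * r2 x0) \<le> C"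
      using C[OF x0] base by blast+
    ultimately have "S \<le> 2 * C + 2 * (e * (2 * C\<^sup>2 * a) * S)"
      using diff[OF x0] unfolding S_def[symmetric] by (simp add: S_def)
    also have "2 * (e * (2 * C\<^sup>2 * a) * S) = (e * (8 * C\<^sup>2 * a)) * (S / 2)" by simp
    also have "\<dots> \<le> 1 * (S / 2)"
      using small by (intro mult_right_mono) (auto simp: e_def S_def)
    finally show ?thesis by simp
  qed
  have "e * (2 * C\<^sup>2 * a) * S \<le> e * (2 * C\<^sup>2 * a) * (4 * C)"
    using S4 \<open>a > 0\<close> by (intro mult_left_mono) (auto simp: e_def)
  also have "\<dots> = 8 * C^3 * a * e" by (simp add: power3_eq_cube power2_eq_square)
  finally show "cmod (u1 x - (u1 0 * p1 x + u2 0 * r1 x)) \<le> 8 * C^3 * a * cmod (mu - lam)"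
    "cmod (u2 x - (u1 0 * p2 x + u2 0 * r2 x)) \<le> 8 * C^3 * a * cmod (mu - lam)"
    using diff[OF x] unfolding e_def by linarith+
qed

text \<open>The initial values do not depend on \<open>mu\<close>, so each limit comes from the
  solution at \<open>lam\<close> with the same initial values. The bound of
  \<open>perturbation\<close> is uniform on \<open>{0..a}\<close> and therefore controls integrals
  as well as endpoint values.\<close>

lemma
  assumes U: "\<And>mu. dirac_pair m q mu (U1 mu) (U2 mu)"
    and U0: "\<And>mu. U1 mu 0 = c1" "\<And>mu. U2 mu 0 = c2" and c: "cmod c1 + cmod c2 \<le> 1"
    and "a > 0"
  shows tendsto_solution1: "((\<lambda>mu. U1 mu a) \<longlongrightarrow> c1 * p1 a + c2 * r1 a) (at lam)"
    and tendsto_solution2: "((\<lambda>mu. U2 mu a) \<longlongrightarrow> c1 * p2 a + c2 * r2 a) (at lam)"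
    and tendsto_pair_integral: "\<And>f g. dirac_pair m q lam f g \<Longrightarrow>
      ((\<lambda>mu. integral {0..a} (\<lambda>t. f t * U1 mu t + g t * U2 mu t)) \<longlongrightarrow>
        integral {0..a} (\<lambda>t. f t * (c1 * p1 t + c2 * r1 t) + g t * (c1 * p2 t + c2 * r2 t))) (at lam)"
proof -
  obtain C where "C > 0"
    and C: "\<And>x. x \<in> {0..a} \<Longrightarrow> cmod (p1 x) \<le> C \<and> cmod (p2 x) \<le> C \<and> cmod (r1 x) \<le> C \<and> cmod (r2 x) \<le> C"
    using solution_bounds[OF \<open>a > 0\<close>] by blast
  define K where "K = 8 * C^3 * a"
  have "K \<ge> 0" using \<open>C > 0\<close> \<open>a > 0\<close> by (simp add: K_def)
  have lim0: "((\<lambda>mu. L * cmod (mu - lam)) \<longlongrightarrow> 0) (at lam)" for L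
    by (auto intro!: tendsto_eq_intros)
  have ev: "\<forall>\<^sub>F mu in at lam. \<forall>x\<in>{0..a}.
      cmod (U1 mu x - (c1 * p1 x + c2 * r1 x)) \<le> K * cmod (mu - lam) \<and>
      cmod (U2 mu x - (c1 * p2 x + c2 * r2 x)) \<le> K * cmod (mu - lam)"
  proof -
    have "\<forall>\<^sub>F mu in at lam. (8 * C\<^sup>2 * a) * cmod (mu - lam) < 1"
      by (rule order_tendstoD(2)[OF lim0]) simp
    then show ?thesis
    proof (rule eventually_mono, intro ballI)
      fix mu x assume "(8 * C\<^sup>2 * a) * cmod (mu - lam) < 1" and x: "x \<in> {0..a}"
      then have small: "cmod (mu - lam) * (8 * C\<^sup>2 * a) \<le> 1" by (simp add: mult.commute)
      have "cmod (U1 mu 0) + cmod (U2 mu 0) \<le> 1" using c U0 by simp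
      from perturbation[OF U \<open>a > 0\<close> C this small x]
      show "cmod (U1 mu x - (c1 * p1 x + c2 * r1 x)) \<le> K * cmod (mu - lam) \<and>
        cmod (U2 mu x - (c1 * p2 x + c2 * r2 x)) \<le> K * cmod (mu - lam)"
        by (simp add: U0 K_def)
    qed
  qed
  have a: "a \<in> {0..a}" using \<open>a > 0\<close> by simp
  have "((\<lambda>mu. U1 mu a - (c1 * p1 a + c2 * r1 a)) \<longlongrightarrow> 0) (at lam)"
    by (rule Lim_null_comparison[OF _ lim0]) (rule eventually_mono[OF ev], use a in blast)
  then show "((\<lambda>mu. U1 mu a) \<longlongrightarrow> c1 * p1 a + c2 * r1 a) (at lam)"
    by (simp add: LIM_zero_iff)
  have "((\<lambda>mu. U2 mu a - (c1 * p2 a + c2 * r2 a)) \<longlongrightarrow> 0) (at lam)"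
    by (rule Lim_null_comparison[OF _ lim0]) (rule eventually_mono[OF ev], use a in blast)
  then show "((\<lambda>mu. U2 mu a) \<longlongrightarrow> c1 * p2 a + c2 * r2 a) (at lam)"
    by (simp add: LIM_zero_iff)
  fix f g assume fg: "dirac_pair m q lam f g"
  note cont = dirac_pair_continuous_on[OF p, of 0 a] dirac_pair_continuous_on[OF r, of 0 a]
    dirac_pair_continuous_on[OF fg, of 0 a]
  from cont(5,6)[THEN continuous_on_Icc_norm_bounded]
  obtain B1 B2 where "\<forall>x\<in>{0..a}. cmod (f x) \<le> B1" "\<forall>x\<in>{0..a}. cmod (g x) \<le> B2" by blast
  then have B: "cmod (f x) \<le> max B1 B2 \<and> cmod (g x) \<le> max B1 B2" if "x \<in> {0..a}" for x
    using that by (meson max.coboundedI1 max.coboundedI2)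
  let ?b1 = "\<lambda>t. c1 * p1 t + c2 * r1 t" and ?b2 = "\<lambda>t. c1 * p2 t + c2 * r2 t"
  have "\<forall>\<^sub>F mu in at lam. norm (integral {0..a} (\<lambda>t. f t * U1 mu t + g t * U2 mu t)
      - integral {0..a} (\<lambda>t. f t * ?b1 t + g t * ?b2 t)) \<le> (max B1 B2 * (2 * K) * a) * cmod (mu - lam)"
    using ev
  proof (rule eventually_mono)
    fix mu assume *: "\<forall>x\<in>{0..a}. cmod (U1 mu x - ?b1 x) \<le> K * cmod (mu - lam) \<and>
        cmod (U2 mu x - ?b2 x) \<le> K * cmod (mu - lam)"
    note contU = dirac_pair_continuous_on[OF U, of 0 a mu]
    have "integral {0..a} (\<lambda>t. f t * U1 mu t + g t * U2 mu t) - integral {0..a} (\<lambda>t. f t * ?b1 t + g t * ?b2 t)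
        = integral {0..a} (\<lambda>t. (f t * U1 mu t + g t * U2 mu t) - (f t * ?b1 t + g t * ?b2 t))"
      by (intro integral_diff[symmetric] integrable_continuous_real continuous_intros cont contU)
    \<comment> \<open>By linearity the difference is again a pair integral, now of the two
      deviations; each is at most \<open>K * cmod (mu - lam)\<close>, whence the factor 2.\<close>
    also have "\<dots> = integral {0..a} (\<lambda>t. f t * (U1 mu t - ?b1 t) + g t * (U2 mu t - ?b2 t))"
      by (simp add: algebra_simps)
    also have "norm \<dots> \<le> max B1 B2 * (2 * K * cmod (mu - lam)) * a"
    proof (rule norm_pair_integral_le[OF cont(5,6) _ _ B _ a])
      show "continuous_on {0..a} (\<lambda>t. U1 mu t - ?b1 t)" "continuous_on {0..a} (\<lambda>t. U2 mu t - ?b2 t)"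
        by (intro continuous_intros cont contU)+
      show "cmod (U1 mu x - ?b1 x) + cmod (U2 mu x - ?b2 x) \<le> 2 * K * cmod (mu - lam)" if "x \<in> {0..a}" for x
        using bspec[OF * that] by linarith
    qed
    finally show "norm (integral {0..a} (\<lambda>t. f t * U1 mu t + g t * U2 mu t)
      - integral {0..a} (\<lambda>t. f t * ?b1 t + g t * ?b2 t)) \<le> (max B1 B2 * (2 * K) * a) * cmod (mu - lam)"
      by (simp add: mult_ac)
  qed
  then have "((\<lambda>mu. integral {0..a} (\<lambda>t. f t * U1 mu t + g t * U2 mu t)
      - integral {0..a} (\<lambda>t. f t * ?b1 t + g t * ?b2 t)) \<longlongrightarrow> 0) (at lam)"
    by (rule Lim_null_comparison[OF _ lim0])
  then show "((\<lambda>mu. integral {0..a} (\<lambda>t. f t * U1 mu t + g t * U2 mu t)) \<longlongrightarrow>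
        integral {0..a} (\<lambda>t. f t * ?b1 t + g t * ?b2 t)) (at lam)"
    by (simp add: LIM_zero_iff)
qed

text \<open>The expression assumed to be nonzero is the derivative of the discriminant at \<open>lam\<close>.\<close>

lemma eventually_trace_ne:
  assumes U: "\<And>mu. dirac_pair m q mu (U1 mu) (U2 mu)" "\<And>mu. U1 mu 0 = 1" "\<And>mu. U2 mu 0 = 0"
    and V: "\<And>mu. dirac_pair m q mu (V1 mu) (V2 mu)" "\<And>mu. V1 mu 0 = 0" "\<And>mu. V2 mu 0 = 1"
    and "a > 0"
    and ne: "(p1 a - r2 a) * integral {0..a} (\<lambda>t. p1 t * r1 t + p2 t * r2 t)
      - r1 a * integral {0..a} (\<lambda>t. p1 t * p1 t + p2 t * p2 t)
      + p2 a * integral {0..a} (\<lambda>t. r1 t * r1 t + r2 t * r2 t) \<noteq> 0"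
  shows "\<forall>\<^sub>F mu in at lam. U1 mu a + V2 mu a \<noteq> p1 a + r2 a"
proof -
  \<comment> \<open>\<open>Q\<close> is the difference quotient of the trace. The representation of
    the two columns makes this exact with no remainder term, so it suffices that \<open>Q\<close>
    has a nonzero limit.\<close>
  define Q where "Q mu = p1 a * integral {0..a} (\<lambda>t. r1 t * U1 mu t + r2 t * U2 mu t)
      - r1 a * integral {0..a} (\<lambda>t. p1 t * U1 mu t + p2 t * U2 mu t)
      + (p2 a * integral {0..a} (\<lambda>t. r1 t * V1 mu t + r2 t * V2 mu t)
      - r2 a * integral {0..a} (\<lambda>t. p1 t * V1 mu t + p2 t * V2 mu t))" for mu
  have eq: "U1 mu a + V2 mu a = p1 a + r2 a + (mu - lam) * Q mu" for mu
  proof -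
    have "U1 mu a = p1 a + (mu - lam) * (p1 a * integral {0..a} (\<lambda>t. r1 t * U1 mu t + r2 t * U2 mu t)
        - r1 a * integral {0..a} (\<lambda>t. p1 t * U1 mu t + p2 t * U2 mu t))"
      using representation(1)[OF U(1), of a mu] \<open>a > 0\<close> by (simp add: U)
    moreover have "V2 mu a = r2 a + (mu - lam) * (p2 a * integral {0..a} (\<lambda>t. r1 t * V1 mu t + r2 t * V2 mu t)
        - r2 a * integral {0..a} (\<lambda>t. p1 t * V1 mu t + p2 t * V2 mu t))"
      using representation(2)[OF V(1), of a mu] \<open>a > 0\<close> by (simp add: V)
    ultimately show ?thesis by (simp add: Q_def distrib_left)
  qed
  have one: "cmod 1 + cmod 0 \<le> 1" "cmod 0 + cmod 1 \<le> 1" by simp_all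
  note lims = tendsto_pair_integral[OF U one(1) \<open>a > 0\<close> r, simplified]
    tendsto_pair_integral[OF U one(1) \<open>a > 0\<close> p, simplified]
    tendsto_pair_integral[OF V one(2) \<open>a > 0\<close> r, simplified]
    tendsto_pair_integral[OF V one(2) \<open>a > 0\<close> p, simplified]
  have "(Q \<longlongrightarrow> p1 a * integral {0..a} (\<lambda>t. r1 t * p1 t + r2 t * p2 t)
      - r1 a * integral {0..a} (\<lambda>t. p1 t * p1 t + p2 t * p2 t)
      + (p2 a * integral {0..a} (\<lambda>t. r1 t * r1 t + r2 t * r2 t)
      - r2 a * integral {0..a} (\<lambda>t. p1 t * r1 t + p2 t * r2 t))) (at lam)" (is "(Q \<longlongrightarrow> ?L) _")
    unfolding Q_def by (intro tendsto_intros lims)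
  moreover have "?L \<noteq> 0" using ne by (simp add: algebra_simps)
  ultimately have "\<forall>\<^sub>F mu in at lam. Q mu \<noteq> 0" by (rule tendsto_imp_eventually_ne)
  moreover have "\<forall>\<^sub>F mu in at lam. mu \<noteq> lam" by (simp add: eventually_at_filter)
  ultimately show ?thesis by eventually_elim (simp add: eq)
qed

section \<open>Solutions at a real spectral parameter\<close>

text \<open>The conjugate solution belongs to the same parameter and has the same initial values.
  With \<open>mu = lam\<close> the integral terms of \<open>representation\<close> drop out, so it
  coincides with the original.\<close>

lemma real_valued:
  assumes "lam \<in> \<real>" "0 \<le> x"
  shows "p1 x \<in> \<real>" "p2 x \<in> \<real>" "r1 x \<in> \<real>" "r2 x \<in> \<real>"
proof -
  obtain l where l: "lam = of_real l" using assms(1) by (auto elim: Reals_cases)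
  have "dirac_pair m q lam (\<lambda>x. cnj (p1 x)) (\<lambda>x. cnj (p2 x))" "dirac_pair m q lam (\<lambda>x. cnj (r1 x)) (\<lambda>x. cnj (r2 x))"
    using p r unfolding l by (auto intro: dirac_pair_cnj)
  from this[THEN representation(1), OF \<open>0 \<le> x\<close>] this[THEN representation(2), OF \<open>0 \<le> x\<close>]
  show "p1 x \<in> \<real>" "p2 x \<in> \<real>" "r1 x \<in> \<real>" "r2 x \<in> \<real>"
    by (auto simp: init Reals_cnj_iff)
qed

text \<open>Everything is real, so \<open>gram_form_nonzero\<close> applies to the real parts, with
  \<open>R1 a\<close> and \<open>P2 a\<close> as \<open>\<beta>\<close> and \<open>\<gamma>\<close>.
  Since the determinant is 1, squared trace 4 means exactly that the discriminant of the form is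
  zero.\<close>

lemma trace_derivative_ne:
  assumes "lam \<in> \<real>" "a > 0" and tr: "(p1 a + r2 a)\<^sup>2 = 4"
    and ne: "\<not> (r1 a = 0 \<and> p2 a = 0)"
  shows "(p1 a - r2 a) * integral {0..a} (\<lambda>t. p1 t * r1 t + p2 t * r2 t)
      - r1 a * integral {0..a} (\<lambda>t. p1 t * p1 t + p2 t * p2 t)
      + p2 a * integral {0..a} (\<lambda>t. r1 t * r1 t + r2 t * r2 t) \<noteq> 0"
proof -
  define P1 P2 R1 R2 where "P1 = Re \<circ> p1" "P2 = Re \<circ> p2" "R1 = Re \<circ> r1" "R2 = Re \<circ> r2"
  note defs = this
  have c: "p1 x = of_real (P1 x)" "p2 x = of_real (P2 x)" "r1 x = of_real (R1 x)" "r2 x = of_real (R2 x)"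
    if "0 \<le> x" for x
    using real_valued[OF assms(1) that] by (simp_all add: defs)
  have cont: "continuous_on {0..a} P1" "continuous_on {0..a} P2" "continuous_on {0..a} R1" "continuous_on {0..a} R2"
    unfolding defs comp_def
    by (intro continuous_intros dirac_pair_continuous_on[OF p] dirac_pair_continuous_on[OF r])+
  have I: "integral {0..a} (\<lambda>t. f1 t * g1 t + f2 t * g2 t) = of_real (integral {0..a} (\<lambda>t. F1 t * G1 t + F2 t * G2 t))"
    if "continuous_on {0..a} F1" "continuous_on {0..a} F2" "continuous_on {0..a} G1" "continuous_on {0..a} G2"
      "\<And>x. 0 \<le> x \<Longrightarrow> f1 x = of_real (F1 x)" "\<And>x. 0 \<le> x \<Longrightarrow> f2 x = of_real (F2 x)"
      "\<And>x. 0 \<le> x \<Longrightarrow> g1 x = of_real (G1 x)" "\<And>x. 0 \<le> x \<Longrightarrow> g2 x = of_real (G2 x)"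
    for f1 f2 g1 g2 :: "real \<Rightarrow> complex" and F1 F2 G1 G2 :: "real \<Rightarrow> real"
  proof -
    have "(\<lambda>t. F1 t * G1 t + F2 t * G2 t) integrable_on {0..a}"
      by (intro integrable_continuous_real continuous_intros that)
    then have "integral {0..a} (of_real \<circ> (\<lambda>t. F1 t * G1 t + F2 t * G2 t))
        = complex_of_real (integral {0..a} (\<lambda>t. F1 t * G1 t + F2 t * G2 t))"
      by (rule integral_linear[OF _ bounded_linear_of_real])
    moreover have "integral {0..a} (\<lambda>t. f1 t * g1 t + f2 t * g2 t)
        = integral {0..a} (complex_of_real \<circ> (\<lambda>t. F1 t * G1 t + F2 t * G2 t))"
      by (rule integral_cong) (simp add: that)
    ultimately show ?thesis by simp
  qed
  have a0: "0 \<le> a" using \<open>a > 0\<close> by simp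
  have "(P1 a + R2 a)\<^sup>2 = 4"
    using tr unfolding c[OF a0] by (metis of_real_add of_real_eq_iff of_real_numeral of_real_power)
  moreover have "P1 a * R2 a - P2 a * R1 a = 1"
    using det_eq_1[OF a0] unfolding c[OF a0] by (metis of_real_1 of_real_diff of_real_eq_iff of_real_mult)
  moreover have "(P1 a - R2 a)\<^sup>2 + 4 * R1 a * P2 a = (P1 a + R2 a)\<^sup>2 - 4 * (P1 a * R2 a - P2 a * R1 a)"
    by (simp add: power2_eq_square algebra_simps)
  ultimately have disc: "(P1 a - R2 a)\<^sup>2 + 4 * R1 a * P2 a = 0" by simp
  have "(P1 a - R2 a) * integral {0..a} (\<lambda>t. P1 t * R1 t + P2 t * R2 t)
      - R1 a * integral {0..a} (\<lambda>t. P1 t * P1 t + P2 t * P2 t)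
      + P2 a * integral {0..a} (\<lambda>t. R1 t * R1 t + R2 t * R2 t) \<noteq> 0"
  proof (rule gram_form_nonzero[OF \<open>a > 0\<close> cont _ _ _ _ disc])
    show "P1 0 = 1" "P2 0 = 0" "R1 0 = 0" "R2 0 = 1" by (simp_all add: defs init)
    show "R1 a \<noteq> 0 \<or> P2 a \<noteq> 0" using ne unfolding c[OF a0] by auto
  qed
  then have "complex_of_real ((P1 a - R2 a) * integral {0..a} (\<lambda>t. P1 t * R1 t + P2 t * R2 t)
      - R1 a * integral {0..a} (\<lambda>t. P1 t * P1 t + P2 t * P2 t)
      + P2 a * integral {0..a} (\<lambda>t. R1 t * R1 t + R2 t * R2 t)) \<noteq> 0" by (simp only: of_real_eq_0_iff not_False_eq_True)
  moreover have
    "integral {0..a} (\<lambda>t. p1 t * r1 t + p2 t * r2 t) = of_real (integral {0..a} (\<lambda>t. P1 t * R1 t + P2 t * R2 t))"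
    "integral {0..a} (\<lambda>t. p1 t * p1 t + p2 t * p2 t) = of_real (integral {0..a} (\<lambda>t. P1 t * P1 t + P2 t * P2 t))"
    "integral {0..a} (\<lambda>t. r1 t * r1 t + r2 t * r2 t) = of_real (integral {0..a} (\<lambda>t. R1 t * R1 t + R2 t * R2 t))"
    by (rule I, (assumption | rule cont c)+)+
  ultimately show ?thesis
    by (simp add: c[OF a0])
qed

end

section \<open>The limit of Gamma at a degenerate point\<close>

theorem theorem6:
  fixes m a lam0 :: real
    and q :: "real \<Rightarrow> real"
    and \<Phi> :: "real \<Rightarrow> complex \<Rightarrow> complex^2^2"
  assumes "m \<ge> 0" and "a > 0"
    and "locally_integrable q" and "\<And>x. q (x + a) = q x"
    and "fundamental_solution m q \<Phi>"
    and "(discriminant a \<Phi> (complex_of_real lam0) = 2 \<and>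
            monodromy a \<Phi> (complex_of_real lam0) \<noteq> mat 1) \<or>
         (discriminant a \<Phi> (complex_of_real lam0) = - 2 \<and>
            monodromy a \<Phi> (complex_of_real lam0) \<noteq> - mat 1)"
  shows "((\<lambda>z. eigenvector_Gamma (monodromy a \<Phi> z)) \<longlongrightarrow> 0) (at (complex_of_real lam0))"
proof -
  let ?l = "complex_of_real lam0"
  let ?M = "\<lambda>z. \<Phi> a z"
  have columns: "dirac_pair m q z (\<lambda>x. \<Phi> x z $ 1 $ j) (\<lambda>x. \<Phi> x z $ 2 $ j)" for z j
    using assms(5) by (auto simp: fundamental_solution_def intro: dirac_solution_column)
  have at_zero: "\<Phi> 0 z $ 1 $ 1 = 1" "\<Phi> 0 z $ 2 $ 1 = 0" "\<Phi> 0 z $ 1 $ 2 = 0" "\<Phi> 0 z $ 2 $ 2 = 1" for z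
    using assms(5) by (auto simp: fundamental_solution_def mat_def)
  have basis: "dirac_basis m q z (\<lambda>x. \<Phi> x z $ 1 $ 1) (\<lambda>x. \<Phi> x z $ 2 $ 1) (\<lambda>x. \<Phi> x z $ 1 $ 2) (\<lambda>x. \<Phi> x z $ 2 $ 2)" for z
    by unfold_locales (use columns at_zero in auto)
  have det: "det (?M z) = 1" for z
    using dirac_basis.det_eq_1[OF basis, of a z] \<open>a > 0\<close> by (simp add: det_2 mult.commute)
  interpret dirac_basis m q ?l "\<lambda>x. \<Phi> x ?l $ 1 $ 1" "\<lambda>x. \<Phi> x ?l $ 2 $ 1" "\<lambda>x. \<Phi> x ?l $ 1 $ 2" "\<lambda>x. \<Phi> x ?l $ 2 $ 2"
    by (rule basis)
  have tr: "trace (?M z) = ?M z $ 1 $ 1 + ?M z $ 2 $ 2" for z by (simp add: trace_def sum_2)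
  have tr4: "(trace (?M ?l))\<^sup>2 = 4"
    using assms(6) by (auto simp: discriminant_def monodromy_def)
  \<comment> \<open>For a diagonal matrix, determinant 1 and squared trace 4 force equal diagonal
    entries. The sign of the trace then makes it the excluded multiple of the unit matrix.\<close>
  have off: "\<not> (?M ?l $ 1 $ 2 = 0 \<and> ?M ?l $ 2 $ 1 = 0)"
  proof
    assume 0: "?M ?l $ 1 $ 2 = 0 \<and> ?M ?l $ 2 $ 1 = 0"
    have "(?M ?l $ 1 $ 1 - ?M ?l $ 2 $ 2)\<^sup>2 = (trace (?M ?l))\<^sup>2 - 4 * det (?M ?l)"
      using 0 unfolding tr det_2 by (simp add: power2_eq_square algebra_simps)
    also have "\<dots> = 0" by (simp add: tr4 det)
    finally have "(?M ?l $ 1 $ 1 - ?M ?l $ 2 $ 2)\<^sup>2 = 0" .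
    then have "?M ?l $ 1 $ 1 = ?M ?l $ 2 $ 2" by simp
    then show False
      using assms(6) 0
      by (auto simp: discriminant_def monodromy_def tr vec_eq_iff forall_2 mat_def)
  qed
  have one: "cmod 1 + cmod 0 \<le> 1" "cmod 0 + cmod 1 \<le> 1" by simp_all
  have lim: "((\<lambda>z. ?M z $ i $ j) \<longlongrightarrow> ?M ?l $ i $ j) (at ?l)" for i j
    using tendsto_solution1[of "\<lambda>z x. \<Phi> x z $ 1 $ 1" "\<lambda>z x. \<Phi> x z $ 2 $ 1",
        OF columns at_zero(1,2) one(1) \<open>a > 0\<close>]
      tendsto_solution2[of "\<lambda>z x. \<Phi> x z $ 1 $ 1" "\<lambda>z x. \<Phi> x z $ 2 $ 1",
        OF columns at_zero(1,2) one(1) \<open>a > 0\<close>]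
      tendsto_solution1[of "\<lambda>z x. \<Phi> x z $ 1 $ 2" "\<lambda>z x. \<Phi> x z $ 2 $ 2",
        OF columns at_zero(3,4) one(2) \<open>a > 0\<close>]
      tendsto_solution2[of "\<lambda>z x. \<Phi> x z $ 1 $ 2" "\<lambda>z x. \<Phi> x z $ 2 $ 2",
        OF columns at_zero(3,4) one(2) \<open>a > 0\<close>]
      exhaust_2[of i] exhaust_2[of j] by auto
  have lim_tr: "((\<lambda>z. trace (?M z)) \<longlongrightarrow> trace (?M ?l)) (at ?l)"
    unfolding tr by (intro tendsto_intros lim)
  let ?D = "\<lambda>z. cmod (eigenvalue_discriminant (?M z))"
  \<comment> \<open>The discriminant is the squared trace minus 4, and this 4 is the squared trace
    at \<open>?l\<close>. Near \<open>?l\<close> the second factor is nonzero by continuity, its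
    limit being twice a trace of modulus 2; the first is nonzero by the nonvanishing
    derivative.\<close>
  have D: "eigenvalue_discriminant (?M z) = (trace (?M z) - trace (?M ?l)) * (trace (?M z) + trace (?M ?l))" for z
    unfolding eigenvalue_discriminant_def det
    using tr4 by (simp add: power2_eq_square algebra_simps)
  have "trace (?M ?l) + trace (?M ?l) \<noteq> 0" using tr4 by auto
  then have "\<forall>\<^sub>F z in at ?l. trace (?M z) + trace (?M ?l) \<noteq> 0"
    by (intro tendsto_imp_eventually_ne[OF tendsto_add[OF lim_tr tendsto_const]])
  moreover have "\<forall>\<^sub>F z in at ?l. trace (?M z) \<noteq> trace (?M ?l)"
    unfolding tr
    by (intro eventually_trace_ne[OF columns at_zero(1,2) columns at_zero(3,4) \<open>a > 0\<close>] trace_derivative_ne)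
      (use tr4 off \<open>a > 0\<close> in \<open>auto simp: tr\<close>)
  ultimately have "\<forall>\<^sub>F z in at ?l. eigenvector_Gamma (?M z) = sqrt (?D z / (deviator_sq (?M z) + ?D z / 2))"
    by eventually_elim (simp add: eigenvector_Gamma_eq D)
  \<comment> \<open>The limit is left unevaluated so that the limit rules match it. The denominator
    has a nonzero limit because \<open>off\<close> makes \<open>deviator_sq\<close> positive at
    \<open>?l\<close>.\<close>
  moreover have "((\<lambda>z. sqrt (?D z / (deviator_sq (?M z) + ?D z / 2))) \<longlongrightarrow> sqrt (0 / (deviator_sq (?M ?l) + 0 / 2))) (at ?l)"
  proof -
    have "((\<lambda>z. (trace (?M z) - trace (?M ?l)) * (trace (?M z) + trace (?M ?l))) \<longlongrightarrow>
        (trace (?M ?l) - trace (?M ?l)) * (trace (?M ?l) + trace (?M ?l))) (at ?l)"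
      by (intro tendsto_intros lim_tr)
    then have "(?D \<longlongrightarrow> 0) (at ?l)"
      unfolding D by (auto dest: tendsto_norm)
    moreover have "((\<lambda>z. deviator_sq (?M z)) \<longlongrightarrow> deviator_sq (?M ?l)) (at ?l)"
      unfolding deviator_sq_def by (intro tendsto_intros lim) auto
    moreover have "deviator_sq (?M ?l) \<noteq> 0"
      using off by (auto simp: deviator_sq_def add_nonneg_eq_0_iff)
    ultimately show ?thesis by (intro tendsto_intros) auto
  qed
  ultimately show ?thesis
    unfolding monodromy_def by (simp add: tendsto_cong)
qed

end
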